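(* Let $A>0$. Among all real-valued potentials $V\in L^1[0,1]$ with $\|V\|_{L^1}\le A$, the quantity $\det\mathscr{T}_V$ attains its maximum at exactly one potential (up to equality a.e.), namely the symmetric pulse \[ V_A=\frac{A}{\ell(A)}\,\chi_{[\frac12-\frac{\ell(A)}2,\ \frac12+\frac{\ell(A)}2]},\qquad \ell(A)=\frac{A}{(1+\sqrt{1+A})^2}. \] The maximum value is \[ \max_{\|V\|_1\le A}\det\mathscr{T}_V=\frac{4}{1+\sqrt{1+A}}\exp\!\Big(\frac{A}{1+\sqrt{1+A}}\Big). \]
   Context: For a real-valued potential $V\in L^q[0,1]$ ($q\ge1$), let $y_V$ be the solution of $-y''+Vy=0$ on $[0,1]$ with $y(0)=0$, $y'(0)=1$. Let $\mathscr{T}_V$ be the Schrödinger operator $\phi\mapsto-\phi''+V\phi$ on $[0,1]$ with Dirichlet conditions $\phi(0)=\phi(1)=0$. Its functional determinant is $\det\mathscr{T}_V=2y_V(1)$. For non-negative $V$ this coincides with the zeta-regularized determinant $e^{-\zeta'_{\mathscr{T}_V}(0)}$, where $\zeta_{\mathscr{T}_V}(s)=\sum_n\lambda_n^{-s}$ over the Dirichlet eigenvalues $\lambda_n$, meromorphically continued. For general $V$, $2y_V(1)$ is the continuous extension of this determinant. $\chi_I$ denotes the indicator function of the interval $I$. *)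

theory Defs
  imports "HOL-Analysis.Analysis"
begin

text \<open>Solutions of -y'' + V y = 0 on [0,1], y(0)=0, y'(0)=1, in the Caratheodory
sense for an integrable potential V: y is differentiable on [0,1] with derivative
y', and y' is the absolutely continuous function y'(t) = 1 + int_0^t V y.\<close>

definition is_sol :: "(real \<Rightarrow> real) \<Rightarrow> (real \<Rightarrow> real) \<Rightarrow> (real \<Rightarrow> real) \<Rightarrow> bool" where
  "is_sol V y y' \<longleftrightarrow>
     y 0 = 0 \<and> y' 0 = 1 \<and>
     (\<forall>t\<in>{0..1}. (y has_real_derivative y' t) (at t within {0..1})) \<and>
     (\<forall>t\<in>{0..1}. set_integrable lborel {0..t} (\<lambda>s. V s * y s) \<and>
                  y' t = 1 + (LINT s:{0..t}|lborel. V s * y s))"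

definition det_T :: "(real \<Rightarrow> real) \<Rightarrow> real" where
  "det_T V = (THE d. \<exists>y y'. is_sol V y y' \<and> d = 2 * y 1)"

definition ell :: "real \<Rightarrow> real" where
  "ell A = A / (1 + sqrt (1 + A))\<^sup>2"

definition pulse :: "real \<Rightarrow> real \<Rightarrow> real" where
  "pulse A = (\<lambda>x. (A / ell A) * indicator {1/2 - ell A / 2 .. 1/2 + ell A / 2} x)"

end

theory Submission
  imports Defs
begin

text \<open>
  Write \<open>h = 1 + sqrt (1 + A)\<close>, so that \<open>A = h\<^sup>2 - 2 h\<close> and the pulse has height \<open>h\<^sup>2\<close> on
  \<open>[1/h, 1 - 1/h]\<close>. Since \<open>\<bar>y\<^sub>V\<bar> \<le> y\<close> for the solution \<open>y\<close> of the potential \<open>\<bar>V\<bar>\<close>, with equality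
  at 1 only if \<open>V = \<bar>V\<bar>\<close> a.e., one may take \<open>V \<ge> 0\<close>. Then \<open>y > 0\<close> on \<open>(0,1]\<close>, and \<open>p = y'/y\<close>
  solves \<open>p' = V - p\<^sup>2\<close>. Let \<open>r\<close> be the logarithmic derivative of the solution for the pulse and
  \<open>q\<close> the diagonal of its Green function, so that \<open>2 q r = 1 + q'\<close> and \<open>q\<close> vanishes at 0 and 1;
  explicitly \<open>q = t - h t\<^sup>2/2\<close> left of the pulse, \<open>q = 1/(2h)\<close> on it, and the reflection on the
  right. Integrating \<open>(ln y + q p)' = q V - q (p - r)\<^sup>2 + q r\<^sup>2\<close> gives
  \<open>ln y(1) = ln (2/h) + (h - 2)/2 + \<integral> q V - \<integral> q (p - r)\<^sup>2\<close>. As \<open>q \<le> 1/(2h)\<close>, the right-hand side is at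
  most \<open>ln (2/h) + h - 2\<close>, and equality forces \<open>p = r\<close>, hence that \<open>V\<close> is the pulse.
\<close>

subsection \<open>Primitives of integrable functions\<close>

text \<open>Integrate \<open>f x * g y\<close> over the plane and split the plane along the
  diagonal: by Fubini each half gives one of the two iterated integrals. This is integration by
  parts at the level of integrable functions, where no derivative has to exist pointwise.\<close>

lemma lborel_integral_parts:
  fixes f g :: "real \<Rightarrow> real"
  assumes f: "integrable lborel f" and g: "integrable lborel g"
  shows "(\<integral>s. f s * (\<integral>r. indicator {..s} r * g r \<partial>lborel) \<partial>lborel)
       + (\<integral>r. g r * (\<integral>s. indicator {..r} s * f s \<partial>lborel) \<partial>lborel)
       = integral\<^sup>L lborel f * integral\<^sup>L lborel g"
proof -
  note [measurable] = borel_measurable_integrable[OF f] borel_measurable_integrable[OF g]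
  let ?P = "lborel \<Otimes>\<^sub>M lborel :: (real \<times> real) measure"
  have I: "integrable ?P (\<lambda>(x, y). f x * g y)"
  proof (rule lborel_pair.Fubini_integrable)
    show "integrable lborel (\<lambda>x. \<integral>y. norm (case (x, y) of (x, y) \<Rightarrow> f x * g y) \<partial>lborel)"
      using f by (simp add: abs_mult)
  qed (use g in auto)
  have I1: "integrable ?P (\<lambda>(x, y). if y \<le> x then f x * g y else 0)"
    by (rule Bochner_Integration.integrable_bound[OF I]) (auto simp: split_beta')
  have I2: "integrable ?P (\<lambda>(x, y). if x < y then f x * g y else 0)"
    by (rule Bochner_Integration.integrable_bound[OF I]) (auto simp: split_beta')
  have 1: "(\<integral>z. (case z of (x, y) \<Rightarrow> if y \<le> x then f x * g y else 0) \<partial>?P)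
      = (\<integral>s. f s * (\<integral>r. indicator {..s} r * g r \<partial>lborel) \<partial>lborel)"
    unfolding lborel_pair.integral_fst'[OF I1, symmetric] integral_mult_right_zero[symmetric]
    by (intro Bochner_Integration.integral_cong refl) (auto simp: indicator_def)
  have 2: "(\<integral>z. (case z of (x, y) \<Rightarrow> if x < y then f x * g y else 0) \<partial>?P)
      = (\<integral>r. g r * (\<integral>s. indicator {..r} s * f s \<partial>lborel) \<partial>lborel)"
  proof -
    have "(\<integral>x. (if x < y then f x * g y else 0) \<partial>lborel)
        = g y * (\<integral>x. indicator {..y} x * f x \<partial>lborel)" for y
    proof -
      \<comment> \<open>The region is \<open>x < y\<close>, whereas the half-line in the statement
        is closed; they differ by the single point \<open>y\<close>, a null set.\<close>
      have "AE x in lborel. x \<noteq> y" by (rule AE_lborel_singleton)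
      then show ?thesis
        unfolding integral_mult_right_zero[symmetric]
        by (intro integral_cong_AE) (auto simp: indicator_def)
    qed
    then show ?thesis
      unfolding lborel_pair.integral_snd[OF I2, symmetric] by simp
  qed
  have "(\<integral>z. (case z of (x, y) \<Rightarrow> f x * g y) \<partial>?P)
     = (\<integral>z. (case z of (x, y) \<Rightarrow> if y \<le> x then f x * g y else 0)
          + (case z of (x, y) \<Rightarrow> if x < y then f x * g y else 0) \<partial>?P)"
    by (intro Bochner_Integration.integral_cong refl) (auto split: prod.splits)
  also have "\<dots> = (\<integral>z. (case z of (x, y) \<Rightarrow> if y \<le> x then f x * g y else 0) \<partial>?P)
          + (\<integral>z. (case z of (x, y) \<Rightarrow> if x < y then f x * g y else 0) \<partial>?P)"
    by (rule Bochner_Integration.integral_add[OF I1 I2])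
  finally show ?thesis
    unfolding 1 2 lborel_pair.integral_fst'[OF I, symmetric] by simp
qed

lemma set_integrable_mult_continuous:
  fixes f g :: "real \<Rightarrow> real"
  assumes f: "set_integrable lborel {a..b} f" and g: "continuous_on {a..b} g"
  shows "set_integrable lborel {a..b} (\<lambda>x. f x * g x)"
proof -
  obtain B where B: "\<And>x. x \<in> {a..b} \<Longrightarrow> \<bar>g x\<bar> \<le> B"
    using compact_imp_bounded[OF compact_continuous_image[OF g]] unfolding bounded_iff
    by (metis compact_Icc image_eqI real_norm_def)
  have "set_borel_measurable borel {a..b} f"
    using borel_measurable_integrable[OF f[unfolded set_integrable_def]]
    by (simp add: set_borel_measurable_def)
  moreover have "set_borel_measurable borel {a..b} g"
    by (rule set_measurable_continuous_on[OF _ g]) simp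
  ultimately have "(\<lambda>x. (indicator {a..b} x *\<^sub>R f x) * (indicator {a..b} x *\<^sub>R g x)) \<in> borel_measurable borel"
    unfolding set_borel_measurable_def by (intro borel_measurable_times)
  moreover have "(\<lambda>x. (indicator {a..b} x *\<^sub>R f x) * (indicator {a..b} x *\<^sub>R g x))
      = (\<lambda>x. indicator {a..b} x *\<^sub>R (f x * g x))"
    by (auto simp: indicator_def)
  ultimately have m: "(\<lambda>x. indicator {a..b} x *\<^sub>R (f x * g x)) \<in> borel_measurable borel"
    by simp
  show ?thesis
    unfolding set_integrable_def
  proof (rule Bochner_Integration.integrable_bound)
    show "integrable lborel (\<lambda>x. B * (indicator {a..b} x *\<^sub>R f x))"
      using f unfolding set_integrable_def by (rule integrable_mult_right)
    have "\<bar>f x * g x\<bar> \<le> \<bar>B * f x\<bar>" if "x \<in> {a..b}" for x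
      using mult_right_mono[of "\<bar>g x\<bar>" "\<bar>B\<bar>" "\<bar>f x\<bar>"] B[OF that] by (simp add: abs_mult mult.commute)
    then show "AE x in lborel. norm (indicator {a..b} x *\<^sub>R (f x * g x)) \<le> norm (B * (indicator {a..b} x *\<^sub>R f x))"
      by (intro AE_I2) (auto simp: indicator_def)
  qed (use m in simp)
qed

lemma set_integrable_Icc_subset:
  fixes f :: "real \<Rightarrow> real"
  assumes "set_integrable lborel {a..b} f" "a \<le> c" "d \<le> b"
  shows "set_integrable lborel {c..d} f"
  by (rule set_integrable_subset[OF assms(1)]) (use assms in auto)

lemmas integrable_on_set_integrable = set_borel_integral_eq_integral(1)
lemmas LINT_eq_integral = set_borel_integral_eq_integral(2)

lemma continuous_on_primitive:
  fixes f :: "real \<Rightarrow> real"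
  assumes "set_integrable lborel {a..b} f"
  shows "continuous_on {a..b} (\<lambda>t. integral {a..t} f)"
  using indefinite_integral_continuous_1 integrable_on_set_integrable[OF assms] .

text \<open>Integration by parts for absolutely continuous functions. For a merely integrable
  potential, \<open>y'\<close> is a primitive but need not be differentiable everywhere, so the
  classical rule does not reach it. Writing \<open>F\<close> and \<open>G\<close> as initial value
  plus primitive leaves two iterated integrals, which Fubini adds up to the product of the total
  integrals.\<close>

lemma integral_parts_primitive:
  fixes f g F G :: "real \<Rightarrow> real"
  assumes f: "set_integrable lborel {a..b} f" and g: "set_integrable lborel {a..b} g" and ab: "a \<le> b"
    and F: "\<And>t. t \<in> {a..b} \<Longrightarrow> F t = F a + integral {a..t} f"
    and G: "\<And>t. t \<in> {a..b} \<Longrightarrow> G t = G a + integral {a..t} g"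
  shows "integral {a..b} (\<lambda>t. f t * G t + F t * g t) = F b * G b - F a * G a"
proof -
  have key: "set_integrable lborel {a..b} (\<lambda>t. u t * integral {a..t} v) \<and>
     (\<integral>s. (indicator {a..b} s *\<^sub>R u s) * (\<integral>r. indicator {..s} r * (indicator {a..b} r *\<^sub>R v r) \<partial>lborel) \<partial>lborel)
     = integral {a..b} (\<lambda>t. u t * integral {a..t} v)"
    if u: "set_integrable lborel {a..b} u" and v: "set_integrable lborel {a..b} v" for u v :: "real \<Rightarrow> real"
  proof
    show 1: "set_integrable lborel {a..b} (\<lambda>t. u t * integral {a..t} v)"
      by (rule set_integrable_mult_continuous[OF u continuous_on_primitive[OF v]])
    have "(\<integral>r. indicator {..s} r * (indicator {a..b} r *\<^sub>R v r) \<partial>lborel) = integral {a..s} v"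
      if "s \<in> {a..b}" for s
    proof -
      have "(\<integral>r. indicator {..s} r * (indicator {a..b} r *\<^sub>R v r) \<partial>lborel) = (LINT r:{a..s}|lborel. v r)"
        unfolding set_lebesgue_integral_def
        by (intro Bochner_Integration.integral_cong refl) (use that in \<open>auto simp: indicator_def\<close>)
      also have "\<dots> = integral {a..s} v"
        by (rule LINT_eq_integral[OF set_integrable_Icc_subset[OF v]]) (use that in auto)
      finally show ?thesis .
    qed
    then have "(\<integral>s. (indicator {a..b} s *\<^sub>R u s) * (\<integral>r. indicator {..s} r * (indicator {a..b} r *\<^sub>R v r) \<partial>lborel) \<partial>lborel)
      = (LINT t:{a..b}|lborel. u t * integral {a..t} v)"
      unfolding set_lebesgue_integral_def
      by (intro Bochner_Integration.integral_cong refl) (auto simp: indicator_def)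
    then show "(\<integral>s. (indicator {a..b} s *\<^sub>R u s) * (\<integral>r. indicator {..s} r * (indicator {a..b} r *\<^sub>R v r) \<partial>lborel) \<partial>lborel)
     = integral {a..b} (\<lambda>t. u t * integral {a..t} v)"
      using LINT_eq_integral[OF 1] by simp
  qed
  let ?f = "integral {a..b} f" and ?g = "integral {a..b} g"
  have 0: "integral {a..b} (\<lambda>t. f t * integral {a..t} g) + integral {a..b} (\<lambda>t. g t * integral {a..t} f) = ?f * ?g"
    using lborel_integral_parts[OF f[unfolded set_integrable_def] g[unfolded set_integrable_def]]
    unfolding conjunct2[OF key[OF f g]] conjunct2[OF key[OF g f]]
      LINT_eq_integral[OF f, symmetric] LINT_eq_integral[OF g, symmetric] set_lebesgue_integral_def .
  note ints = integrable_on_set_integrable[OF f] integrable_on_set_integrable[OF g]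
     integrable_on_set_integrable[OF conjunct1[OF key[OF f g]]] integrable_on_set_integrable[OF conjunct1[OF key[OF g f]]]
  have "integral {a..b} (\<lambda>t. f t * G t + F t * g t)
     = integral {a..b} (\<lambda>t. (G a * f t + F a * g t) + (f t * integral {a..t} g + g t * integral {a..t} f))"
    by (rule Henstock_Kurzweil_Integration.integral_cong) (simp only: F[of "_"] G[of "_"], simp add: algebra_simps)
  also have "\<dots> = (G a * ?f + F a * ?g) + ?f * ?g"
    using ints by (simp add: Henstock_Kurzweil_Integration.integral_add integrable_add integrable_on_mult_right 0[symmetric]
        del: integrable_on_mult_right_iff)
  also have "\<dots> = F b * G b - F a * G a"
    using F[of b] G[of b] ab by (simp add: algebra_simps)
  finally show ?thesis .
qed

text \<open>Extend \<open>f\<close> by zero and take its positive and negative parts as densities of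
  two finite measures. The hypothesis makes these agree on every half-line \<open>{t<..}\<close>, so
  the measures coincide, and uniqueness of densities makes the two parts equal almost everywhere.
  Both parts can be equal only where they vanish.\<close>

lemma AE_zero_if_interval_integrals_zero:
  fixes f :: "real \<Rightarrow> real"
  assumes f: "set_integrable lborel {a..b} f"
    and z: "\<And>t. t \<in> {a..b} \<Longrightarrow> integral {t..b} f = 0"
  shows "AE x in lborel. x \<in> {a..b} \<longrightarrow> f x = 0"
proof -
  define u where "u x = indicator {a..b} x *\<^sub>R f x" for x
  have u: "integrable lborel u" using f unfolding set_integrable_def u_def .
  note [measurable] = borel_measurable_integrable[OF u]
  define p n where "p x = ennreal (max 0 (u x))" and "n x = ennreal (max 0 (- u x))" for x
  have [measurable]: "p \<in> borel_measurable borel" "n \<in> borel_measurable borel"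
    unfolding p_def n_def by measurable
  have ip: "integrable lborel (\<lambda>x. max 0 (u x) * indicator {t<..} x)" for t
    by (rule Bochner_Integration.integrable_bound[OF u]) (auto simp: indicator_def)
  have inn: "integrable lborel (\<lambda>x. max 0 (- u x) * indicator {t<..} x)" for t
    by (rule Bochner_Integration.integrable_bound[OF u]) (auto simp: indicator_def)
  have ep: "emeasure (density lborel p) {t<..} = ennreal (\<integral>x. max 0 (u x) * indicator {t<..} x \<partial>lborel)" for t
    unfolding p_def
    by (subst emeasure_density; simp?; subst nn_integral_eq_integral[OF ip, symmetric])
      (auto intro!: nn_integral_cong simp: indicator_def)
  have en: "emeasure (density lborel n) {t<..} = ennreal (\<integral>x. max 0 (- u x) * indicator {t<..} x \<partial>lborel)" for t
    unfolding n_def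
    by (subst emeasure_density; simp?; subst nn_integral_eq_integral[OF inn, symmetric])
      (auto intro!: nn_integral_cong simp: indicator_def)
  have 0: "(\<integral>x. u x * indicator {t<..} x \<partial>lborel) = 0" for t
  proof (cases "t < b")
    case True
    have "AE x in lborel. x \<noteq> t" by (rule AE_lborel_singleton)
    then have "(\<integral>x. u x * indicator {t<..} x \<partial>lborel) = (LINT x:{max a t..b}|lborel. f x)"
      using borel_measurable_integrable[OF set_integrable_Icc_subset[OF f, of "max a t" b, unfolded set_integrable_def]]
      unfolding set_lebesgue_integral_def
      by (intro integral_cong_AE) (simp, simp, auto simp: u_def indicator_def)
    also have "\<dots> = integral {max a t..b} f"
      by (rule LINT_eq_integral[OF set_integrable_Icc_subset[OF f]]) auto
    also have "\<dots> = 0"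
      using z[of "max a t"] True by (cases "a \<le> b") auto
    finally show ?thesis .
  next
    case False
    then have "(\<lambda>x. u x * indicator {t<..} x) = (\<lambda>_. 0)" by (auto simp: u_def indicator_def)
    then show ?thesis by simp
  qed
  have "(\<integral>x. max 0 (u x) * indicator {t<..} x \<partial>lborel) = (\<integral>x. max 0 (- u x) * indicator {t<..} x \<partial>lborel)" for t
  proof -
    have "(\<integral>x. max 0 (u x) * indicator {t<..} x \<partial>lborel) - (\<integral>x. max 0 (- u x) * indicator {t<..} x \<partial>lborel)
      = (\<integral>x. u x * indicator {t<..} x \<partial>lborel)"
      unfolding Bochner_Integration.integral_diff[OF ip inn, symmetric]
      by (intro Bochner_Integration.integral_cong refl) (auto simp: indicator_def)
    then show ?thesis using 0 by simp
  qed
  then have "density lborel p = density lborel n"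
    by (intro measure_eqI_lessThan) (auto simp: ep en)
  then have "AE x in lborel. p x = n x"
    by (subst (asm) sigma_finite_measure.density_unique_iff[OF sigma_finite_lborel]) auto
  then show ?thesis
    by eventually_elim (auto simp: p_def n_def u_def max_def split: if_splits)
qed

subsection \<open>Uniqueness and comparison of solutions\<close>

text \<open>Integration by parts against \<open>t - s\<close>, whose boundary terms vanish at both
  ends. It turns the twice integrated differential equation into a Volterra equation with kernel
  \<open>t - s\<close>, which lies between 0 and 1 for \<open>s\<close> in \<open>{0..t}\<close> and
  \<open>t\<close> in \<open>{0..1}\<close>.\<close>

lemma integral_double_primitive:
  fixes f :: "real \<Rightarrow> real"
  assumes f: "set_integrable lborel {a..t} f" and t: "a \<le> t"
  shows "integral {a..t} (\<lambda>s. integral {a..s} f) = integral {a..t} (\<lambda>s. (t - s) * f s)"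
proof -
  have i: "(\<lambda>s. f s * (t - s)) integrable_on {a..t}"
    by (intro integrable_on_set_integrable set_integrable_mult_continuous f continuous_intros)
  have j: "(\<lambda>s. integral {a..s} f) integrable_on {a..t}"
    by (intro integrable_continuous_interval continuous_on_primitive f)
  have "integral {a..t} (\<lambda>s. f s * (t - s) + integral {a..s} f * (-1)) = integral {a..t} f * (t - t) - integral {a..a} f * (t - a)"
    by (rule integral_parts_primitive[OF f]) (use t in \<open>auto intro: borel_integrable_atLeastAtMost'\<close>)
  then have "integral {a..t} (\<lambda>s. f s * (t - s) - integral {a..s} f) = 0" by simp
  then show ?thesis
    unfolding Henstock_Kurzweil_Integration.integral_diff[OF i j] by (simp add: mult.commute)
qed

text \<open>This is the chain rule for a power of a primitive. As \<open>K\<close> is only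
  absolutely continuous, it is obtained by induction on the exponent, with integration by parts
  applied to \<open>K * K ^ Suc n\<close>.\<close>

lemma integral_mult_primitive_power:
  fixes k K :: "real \<Rightarrow> real"
  assumes k: "set_integrable lborel {a..b} k"
    and K: "\<And>t. t \<in> {a..b} \<Longrightarrow> K t = integral {a..t} k"
    and t: "t \<in> {a..b}"
  shows "integral {a..t} (\<lambda>s. k s * K s ^ n) = K t ^ Suc n / Suc n"
proof -
  have contK: "continuous_on {a..b} K"
    using continuous_on_primitive[OF k] K by (subst continuous_on_cong[OF refl]) auto
  have "K t ^ Suc n = integral {a..t} (\<lambda>s. real (Suc n) * (k s * K s ^ n))" using t
  proof (induction n arbitrary: t)
    case 0
    then show ?case using K by simp
  next
    case (Suc n)
    have kt: "set_integrable lborel {a..t} k"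
      by (rule set_integrable_Icc_subset[OF k]) (use Suc.prems in auto)
    have ct: "continuous_on {a..t} K"
      by (rule continuous_on_subset[OF contK]) (use Suc.prems in auto)
    have at: "a \<le> t" using Suc.prems by simp
    have Ka: "K a = 0" using K[of a] Suc.prems by simp
    have "integral {a..t} (\<lambda>s. k s * K s ^ Suc n + K s * (real (Suc n) * (k s * K s ^ n)))
        = K t * K t ^ Suc n - K a * K a ^ Suc n"
    proof (rule integral_parts_primitive[OF kt _ at])
      show "set_integrable lborel {a..t} (\<lambda>s. real (Suc n) * (k s * K s ^ n))"
        by (intro set_integrable_mult_right set_integrable_mult_continuous kt continuous_intros ct)
    next
      fix s assume s: "s \<in> {a..t}"
      then have s': "s \<in> {a..b}" using Suc.prems by auto
      show "K s = K a + integral {a..s} k" using K[OF s'] Ka by simp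
      show "K s ^ Suc n = K a ^ Suc n + integral {a..s} (\<lambda>s. real (Suc n) * (k s * K s ^ n))"
        using Suc.IH[OF s'] Ka by simp
    qed
    then show ?case by (simp add: Ka algebra_simps)
  qed
  then have "K t ^ Suc n = real (Suc n) * integral {a..t} (\<lambda>s. k s * K s ^ n)"
    by (simp del: of_nat_Suc power_Suc)
  then show ?thesis by (simp del: of_nat_Suc power_Suc)
qed

text \<open>Feeding the inequality into itself \<open>n\<close> times, starting from an upper bound
  \<open>M\<close>, yields \<open>f t <= M * K t ^ n / fact n\<close>, where \<open>K\<close> is the
  primitive of \<open>k\<close>. The factorial sends this to 0. Iteration replaces the usual
  integrating factor, so no derivative of \<open>K\<close> is used.\<close>

lemma gronwall_zero:
  fixes f k :: "real \<Rightarrow> real"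
  assumes k: "set_integrable lborel {a..b} k" and k0: "\<And>s. s \<in> {a..b} \<Longrightarrow> 0 \<le> k s"
    and f: "continuous_on {a..b} f"
    and le: "\<And>t. t \<in> {a..b} \<Longrightarrow> f t \<le> integral {a..t} (\<lambda>s. k s * f s)"
    and t: "t \<in> {a..b}"
  shows "f t \<le> 0"
proof -
  define K where "K t = integral {a..t} k" for t
  obtain M where M: "\<And>x. x \<in> {a..b} \<Longrightarrow> \<bar>f x\<bar> \<le> M"
    using compact_imp_bounded[OF compact_continuous_image[OF f]] unfolding bounded_iff
    by (metis compact_Icc image_eqI real_norm_def)
  have contK: "continuous_on {a..b} K"
    using continuous_on_primitive[OF k] unfolding K_def .
  have bound: "f t \<le> M * K t ^ n / fact n" if "t \<in> {a..b}" for t n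
    using that
  proof (induction n arbitrary: t)
    case 0
    then show ?case using M[of t] by simp
  next
    case (Suc n)
    have kt: "set_integrable lborel {a..t} k"
      by (rule set_integrable_Icc_subset[OF k]) (use Suc.prems in auto)
    have ft: "continuous_on {a..t} f"
      by (rule continuous_on_subset[OF f]) (use Suc.prems in auto)
    have Kt: "continuous_on {a..t} K"
      by (rule continuous_on_subset[OF contK]) (use Suc.prems in auto)
    have "f t \<le> integral {a..t} (\<lambda>s. k s * f s)" using le Suc.prems by simp
    also have "\<dots> \<le> integral {a..t} (\<lambda>s. k s * (M * K s ^ n / fact n))"
    proof (rule integral_le)
      fix s assume "s \<in> {a..t}"
      then have "s \<in> {a..b}" using Suc.prems by auto
      then show "k s * f s \<le> k s * (M * K s ^ n / fact n)"
        using Suc.IH k0 by (intro mult_left_mono) auto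
    qed (intro integrable_on_set_integrable set_integrable_mult_continuous kt ft Kt continuous_intros; simp)+
    also have "\<dots> = integral {a..t} (\<lambda>s. (M / fact n) * (k s * K s ^ n))"
      by (rule Henstock_Kurzweil_Integration.integral_cong) (simp add: field_simps)
    also have "\<dots> = (M / fact n) * (K t ^ Suc n / Suc n)"
      using integral_mult_primitive_power[OF k K_def Suc.prems, of n] by simp
    also have "\<dots> = M * K t ^ Suc n / fact (Suc n)" by simp
    finally show ?case .
  qed
  have "(\<lambda>n. K t ^ n / fact n) \<longlonglongrightarrow> 0"
    using summable_LIMSEQ_zero[OF summable_exp_generic[of "K t"]]
    by (simp add: divide_inverse mult.commute)
  then have "(\<lambda>n. M * (K t ^ n / fact n)) \<longlonglongrightarrow> M * 0" by (intro tendsto_intros)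
  then show ?thesis
    using bound[OF t] by (intro LIMSEQ_le_const[where X="\<lambda>n. M * (K t ^ n / fact n)"]) auto
qed

text \<open>The working form of a solution: Lebesgue integrals become gauge integrals, and the last
  fact is the Volterra equation on which the Gronwall arguments operate.\<close>

lemma is_sol_unfold:
  assumes V: "set_integrable lborel {0..1} V" and s: "is_sol V y y'"
  shows "continuous_on {0..1} y" "continuous_on {0..1} y'"
    "set_integrable lborel {0..1} (\<lambda>s. V s * y s)"
    "\<And>t. t \<in> {0..1} \<Longrightarrow> y' t = 1 + integral {0..t} (\<lambda>s. V s * y s)"
    "\<And>t. t \<in> {0..1} \<Longrightarrow> y t = t + integral {0..t} (\<lambda>s. (t - s) * (V s * y s))"
proof -
  have D: "\<And>t. t \<in> {0..1} \<Longrightarrow> (y has_real_derivative y' t) (at t within {0..1})"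
    and y0: "y 0 = 0"
    using s unfolding is_sol_def by auto
  show c: "continuous_on {0..1} y"
    using D DERIV_continuous continuous_on_eq_continuous_within by blast
  show i: "set_integrable lborel {0..1} (\<lambda>s. V s * y s)"
    by (rule set_integrable_mult_continuous[OF V c])
  show y': "y' t = 1 + integral {0..t} (\<lambda>s. V s * y s)" if "t \<in> {0..1}" for t
  proof -
    have "set_integrable lborel {0..t} (\<lambda>s. V s * y s)" "y' t = 1 + (LINT s:{0..t}|lborel. V s * y s)"
      using s that unfolding is_sol_def by blast+
    then show ?thesis by (simp only: LINT_eq_integral)
  qed
  have "continuous_on {0..1} (\<lambda>t. 1 + integral {0..t} (\<lambda>s. V s * y s))"
    by (intro continuous_intros continuous_on_primitive i)
  then show "continuous_on {0..1} y'"
    using y' by (subst continuous_on_cong[OF refl]) auto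
  show "y t = t + integral {0..t} (\<lambda>s. (t - s) * (V s * y s))" if t: "t \<in> {0..1}" for t
  proof -
    have it: "set_integrable lborel {0..t} (\<lambda>s. V s * y s)"
      by (rule set_integrable_Icc_subset[OF i]) (use t in auto)
    have "(y' has_integral y t - y 0) {0..t}"
    proof (rule fundamental_theorem_of_calculus)
      fix x assume "x \<in> {0..t}"
      then show "(y has_vector_derivative y' x) (at x within {0..t})"
        using t DERIV_subset[OF D[of x], of "{0..t}"] by (auto simp: has_real_derivative_iff_has_vector_derivative)
    qed (use t in auto)
    then have "y t = integral {0..t} y'" using y0 by (simp add: has_integral_iff)
    also have "\<dots> = integral {0..t} (\<lambda>r. 1 + integral {0..r} (\<lambda>s. V s * y s))"
      by (rule Henstock_Kurzweil_Integration.integral_cong) (use y' t in auto)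
    also have "\<dots> = t + integral {0..t} (\<lambda>r. integral {0..r} (\<lambda>s. V s * y s))"
      using t integrable_continuous_interval[OF continuous_on_primitive[OF it]]
      by (subst Henstock_Kurzweil_Integration.integral_add) auto
    finally show ?thesis
      using integral_double_primitive[OF it] t by simp
  qed
qed

text \<open>Subtract the Volterra equations and apply Gronwall to the positive part of
  \<open>\<bar>y\<bar> - z\<close>. Passing to the positive part matters because the factor
  \<open>t - s\<close> may then be replaced by 1 without reversing the estimate.\<close>

lemma is_sol_compare:
  assumes V: "set_integrable lborel {0..1} V" and s: "is_sol V y y'"
    and W: "set_integrable lborel {0..1} W" and z: "is_sol W z z'"
    and le: "\<And>t. t \<in> {0..1} \<Longrightarrow> \<bar>V t\<bar> \<le> W t" and t: "t \<in> {0..1}"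
  shows "\<bar>y t\<bar> \<le> z t"
proof -
  note Y = is_sol_unfold[OF V s] and Z = is_sol_unfold[OF W z]
  let ?e = "\<lambda>t. max 0 (\<bar>y t\<bar> - z t)"
  have ce: "continuous_on {0..1} ?e"
    by (intro continuous_intros Y(1) Z(1))
  have "?e t \<le> 0"
  proof (rule gronwall_zero[OF W _ ce _ t])
    show "0 \<le> W s" if "s \<in> {0..1}" for s using le[OF that] by linarith
    fix t :: real assume t: "t \<in> {0..1}"
    have W': "set_integrable lborel {0..t} W" and V': "set_integrable lborel {0..t} (\<lambda>s. V s * y s)"
      and Wz: "set_integrable lborel {0..t} (\<lambda>s. W s * z s)"
      by (rule set_integrable_Icc_subset, rule W Y(3) Z(3), (use t in auto)[2])+
    have ie: "(\<lambda>s. W s * ?e s) integrable_on {0..t}"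
      by (intro integrable_on_set_integrable set_integrable_mult_continuous W' continuous_on_subset[OF ce]) (use t in auto)
    have iv: "(\<lambda>s. (t - s) * (V s * y s)) integrable_on {0..t}"
      and iva: "(\<lambda>s. \<bar>(t - s) * (V s * y s)\<bar>) integrable_on {0..t}"
      and iw: "(\<lambda>s. (t - s) * (W s * z s)) integrable_on {0..t}"
      by (subst mult.commute, intro integrable_on_set_integrable set_integrable_abs set_integrable_mult_continuous V' Wz continuous_intros)+
    have "\<bar>y t\<bar> \<le> t + \<bar>integral {0..t} (\<lambda>s. (t - s) * (V s * y s))\<bar>"
      using Y(5)[OF t] t by auto
    also have "\<dots> \<le> t + integral {0..t} (\<lambda>s. \<bar>(t - s) * (V s * y s)\<bar>)"
      using integral_norm_bound_integral[OF iv iva] by simp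
    finally have "\<bar>y t\<bar> - z t \<le> integral {0..t} (\<lambda>s. \<bar>(t - s) * (V s * y s)\<bar> - (t - s) * (W s * z s))"
      unfolding Henstock_Kurzweil_Integration.integral_diff[OF iva iw] using Z(5)[OF t] by simp
    also have "\<dots> \<le> integral {0..t} (\<lambda>s. W s * ?e s)"
    proof (rule integral_le[OF integrable_diff[OF iva iw] ie])
      fix s assume s: "s \<in> {0..t}"
      then have s': "s \<in> {0..1}" using t by auto
      have "\<bar>(t - s) * (V s * y s)\<bar> - (t - s) * (W s * z s) = (t - s) * (\<bar>V s\<bar> * \<bar>y s\<bar> - W s * z s)"
        using s by (simp only: abs_mult) (simp add: right_diff_distrib)
      also have "\<dots> \<le> (t - s) * (W s * \<bar>y s\<bar> - W s * z s)"
        using le[OF s'] s by (intro mult_left_mono diff_right_mono mult_right_mono) auto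
      also have "\<dots> = (t - s) * (W s * (\<bar>y s\<bar> - z s))" by (simp add: algebra_simps)
      also have "\<dots> \<le> (t - s) * (W s * ?e s)"
        using le[OF s'] s by (intro mult_left_mono) auto
      also have "\<dots> \<le> 1 * (W s * ?e s)"
        using le[OF s'] s t by (intro mult_right_mono mult_nonneg_nonneg) auto
      finally show "\<bar>(t - s) * (V s * y s)\<bar> - (t - s) * (W s * z s) \<le> W s * ?e s" by simp
    qed
    finally have "\<bar>y t\<bar> - z t \<le> integral {0..t} (\<lambda>s. W s * ?e s)" .
    moreover have "0 \<le> integral {0..t} (\<lambda>s. W s * ?e s)"
          proof (rule integral_nonneg[OF ie])
      fix s assume "s \<in> {0..t}"
      then have "0 \<le> W s" using le[of s] t by auto
      then show "0 \<le> W s * ?e s" by simp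
    qed
    ultimately show "?e t \<le> integral {0..t} (\<lambda>s. W s * ?e s)" by simp
  qed
  then show ?thesis by simp
qed

lemma is_sol_unique:
  assumes V: "set_integrable lborel {0..1} V" and s: "is_sol V y y'" and z: "is_sol V z z'" and t: "t \<in> {0..1}"
  shows "y t = z t"
proof -
  note Y = is_sol_unfold[OF V s] and Z = is_sol_unfold[OF V z]
  let ?e = "\<lambda>t. \<bar>y t - z t\<bar>"
  have ce: "continuous_on {0..1} ?e"
    by (intro continuous_intros Y(1) Z(1))
  have "?e t \<le> 0"
  proof (rule gronwall_zero[OF set_integrable_abs[OF V] _ ce _ t])
    fix t :: real assume t: "t \<in> {0..1}"
    have V': "set_integrable lborel {0..t} V" and Vy: "set_integrable lborel {0..t} (\<lambda>s. V s * y s)"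
      and Vz: "set_integrable lborel {0..t} (\<lambda>s. V s * z s)"
      by (rule set_integrable_Icc_subset, rule V Y(3) Z(3), (use t in auto)[2])+
    have ie: "(\<lambda>s. \<bar>V s\<bar> * ?e s) integrable_on {0..t}"
      by (intro integrable_on_set_integrable set_integrable_mult_continuous set_integrable_abs V' continuous_on_subset[OF ce]) (use t in auto)
    have iv: "(\<lambda>s. (t - s) * (V s * y s)) integrable_on {0..t}"
      and iw: "(\<lambda>s. (t - s) * (V s * z s)) integrable_on {0..t}"
      by (subst mult.commute, intro integrable_on_set_integrable set_integrable_mult_continuous Vy Vz continuous_intros)+
    have "?e t = \<bar>integral {0..t} (\<lambda>s. (t - s) * (V s * y s) - (t - s) * (V s * z s))\<bar>"
      unfolding Henstock_Kurzweil_Integration.integral_diff[OF iv iw] using Z(5)[OF t] Y(5)[OF t] by simp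
    also have "\<dots> \<le> integral {0..t} (\<lambda>s. \<bar>V s\<bar> * ?e s)"
      unfolding real_norm_def[symmetric, of "integral _ _"]
    proof (rule integral_norm_bound_integral[OF integrable_diff[OF iv iw] ie])
      fix s assume s: "s \<in> {0..t}"
      have "norm ((t - s) * (V s * y s) - (t - s) * (V s * z s)) = (t - s) * (\<bar>V s\<bar> * ?e s)"
        using s by (simp only: right_diff_distrib[symmetric] real_norm_def abs_mult) simp
      also have "\<dots> \<le> 1 * (\<bar>V s\<bar> * ?e s)"
        using s t by (intro mult_right_mono) auto
      finally show "norm ((t - s) * (V s * y s) - (t - s) * (V s * z s)) \<le> \<bar>V s\<bar> * ?e s" by simp
    qed
    finally show "?e t \<le> integral {0..t} (\<lambda>s. \<bar>V s\<bar> * ?e s)" .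
  qed simp
  then show ?thesis by simp
qed

subsection \<open>Existence of solutions\<close>

text \<open>Neumann series for the Volterra equation. \<open>d n\<close> is the \<open>n\<close>-th
  iterate of the Volterra operator on the free solution \<open>t\<close>, and it is bounded by
  \<open>K t ^ n / fact n\<close> with \<open>K\<close> the primitive of
  \<open>\<bar>V\<bar>\<close>. The series therefore converges uniformly on
  \<open>{0..1}\<close>.\<close>

lemma is_sol_exists:
  assumes V: "set_integrable lborel {0..1} V"
  shows "\<exists>y y'. is_sol V y y'"
proof -
  define d :: "nat \<Rightarrow> real \<Rightarrow> real" where
    "d = rec_nat (\<lambda>t. t) (\<lambda>_ u t. integral {0..t} (\<lambda>s. (t - s) * (V s * u s)))"
  have d0: "d 0 = (\<lambda>t. t)" and dS: "\<And>n. d (Suc n) = (\<lambda>t. integral {0..t} (\<lambda>s. (t - s) * (V s * d n s)))"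
    by (simp_all add: d_def)
  have Vt: "set_integrable lborel {0..t} (\<lambda>s. V s * u s)" if "t \<in> {0..1}" "continuous_on {0..1} u" for t u
    by (rule set_integrable_Icc_subset[OF set_integrable_mult_continuous[OF V that(2)]]) (use that(1) in auto)
  have It: "(\<lambda>s. (t - s) * (V s * u s)) integrable_on {0..t}" if "t \<in> {0..1}" "continuous_on {0..1} u" for t u
    by (subst mult.commute, intro integrable_on_set_integrable set_integrable_mult_continuous Vt that continuous_intros)
  have cont: "continuous_on {0..1} (d n)" for n
  proof (induction n)
    case 0
    then show ?case by (simp add: d0)
  next
    case (Suc n)
    have "continuous_on {0..1} (\<lambda>t. integral {0..t} (\<lambda>r. integral {0..r} (\<lambda>s. V s * d n s)))"
      by (intro continuous_on_primitive borel_integrable_atLeastAtMost' Vt Suc.IH) auto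
    then show ?case
      using integral_double_primitive[OF Vt[OF _ Suc.IH]] by (subst continuous_on_cong[OF refl]) (auto simp: dS)
  qed
  define k K where "k s = \<bar>V s\<bar>" and "K t = integral {0..t} k" for s t
  have k: "set_integrable lborel {0..1} k" unfolding k_def by (rule set_integrable_abs[OF V])
  have kt: "set_integrable lborel {0..t} k" if "t \<in> {0..1}" for t
    by (rule set_integrable_Icc_subset[OF k]) (use that in auto)
  have contK: "continuous_on {0..1} K" unfolding K_def by (rule continuous_on_primitive[OF k])
  have K0: "0 \<le> K t" "K t \<le> K 1" if "t \<in> {0..1}" for t
    unfolding K_def
    by (rule integral_nonneg[OF integrable_on_set_integrable[OF kt[OF that]]], simp add: k_def)
      (rule integral_subset_le, use that in \<open>auto intro!: integrable_on_set_integrable kt simp: k_def[of "_"]\<close>)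
  have bound: "\<bar>d n t\<bar> \<le> K t ^ n / fact n" if "t \<in> {0..1}" for n t
    using that
  proof (induction n arbitrary: t)
    case 0
    then show ?case by (simp add: d0)
  next
    case (Suc n)
    have Kt: "continuous_on {0..t} K"
      by (rule continuous_on_subset[OF contK]) (use Suc.prems in auto)
    have "\<bar>d (Suc n) t\<bar> \<le> integral {0..t} (\<lambda>s. (1 / fact n) * (k s * K s ^ n))"
      unfolding dS real_norm_def[symmetric, of "integral _ _"]
    proof (rule integral_norm_bound_integral[OF It[OF Suc.prems cont]])
      show "(\<lambda>s. (1 / fact n) * (k s * K s ^ n)) integrable_on {0..t}"
        by (intro integrable_on_set_integrable set_integrable_mult_right set_integrable_mult_continuous kt Suc.prems continuous_intros Kt)
      fix s assume s: "s \<in> {0..t}"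
      then have s': "s \<in> {0..1}" using Suc.prems by auto
      have "norm ((t - s) * (V s * d n s)) = (t - s) * (k s * \<bar>d n s\<bar>)"
        using s by (simp add: abs_mult k_def)
      also have "\<dots> \<le> 1 * (k s * (K s ^ n / fact n))"
        using s Suc.prems Suc.IH[OF s'] by (intro mult_mono mult_nonneg_nonneg) (auto simp: k_def)
      finally show "norm ((t - s) * (V s * d n s)) \<le> (1 / fact n) * (k s * K s ^ n)" by simp
    qed
    also have "\<dots> = K t ^ Suc n / fact (Suc n)"
      using integral_mult_primitive_power[OF k K_def Suc.prems, of n] by simp
    finally show ?case .
  qed
  define M where "M n = K 1 ^ n / fact n" for n
  have sM: "summable M"
    using summable_exp_generic[of "K 1"] unfolding M_def by (simp add: divide_inverse mult.commute)
  have M0: "0 \<le> M n" for n using K0(1)[of 1] by (simp add: M_def)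
  have dM: "norm (d n t) \<le> M n" if "t \<in> {0..1}" for n t
  proof -
    have "K t ^ n / fact n \<le> K 1 ^ n / fact n"
      using K0[OF that] by (intro divide_right_mono power_mono) auto
    then show ?thesis using bound[OF that, of n] unfolding M_def real_norm_def by linarith
  qed
  define S where "S N t = (\<Sum>n<N. d n t)" for N t
  define y where "y t = (\<Sum>n. d n t)" for t
  have ul: "uniform_limit {0..1} S y sequentially"
    unfolding S_def y_def by (rule Weierstrass_m_test[OF dM sM])
  have contS: "continuous_on {0..1} (S N)" for N
    unfolding S_def by (intro continuous_intros cont)
  have conty: "continuous_on {0..1} y"
    by (rule uniform_limit_theorem[OF _ ul]) (auto intro: always_eventually contS)
  have lim: "(\<lambda>N. S N t) \<longlonglongrightarrow> y t" if "t \<in> {0..1}" for t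
    using tendsto_uniform_limitI[OF ul that] .
  have Sb: "\<bar>S N t\<bar> \<le> suminf M" if "t \<in> {0..1}" for N t
  proof -
    have "\<bar>S N t\<bar> \<le> (\<Sum>n<N. M n)"
      unfolding S_def using dM[OF that] by (intro order_trans[OF sum_abs sum_mono]) auto
    also have "\<dots> \<le> suminf M" by (rule sum_le_suminf[OF sM]) (auto simp: M0)
    finally show ?thesis .
  qed
  have eq: "y t = t + integral {0..t} (\<lambda>s. (t - s) * (V s * y s))" if t: "t \<in> {0..1}" for t
  proof -
    have step: "S (Suc N) t = t + integral {0..t} (\<lambda>s. (t - s) * (V s * S N s))" for N
    proof -
      have "S (Suc N) t = t + (\<Sum>n<N. integral {0..t} (\<lambda>s. (t - s) * (V s * d n s)))"
        unfolding S_def by (subst sum.lessThan_Suc_shift) (simp add: d0 dS)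
      also have "\<dots> = t + integral {0..t} (\<lambda>s. \<Sum>n<N. (t - s) * (V s * d n s))"
        by (subst integral_sum) (auto intro: It[OF t cont])
      finally show ?thesis by (simp add: S_def sum_distrib_left)
    qed
    \<comment> \<open>The partial sums are bounded by \<open>suminf M\<close> uniformly in
      \<open>N\<close>, so \<open>k s * suminf M\<close> is an integrable majorant and the limit may
      be taken under the integral.\<close>
    have "(\<lambda>N. integral {0..t} (\<lambda>s. (t - s) * (V s * S N s))) \<longlonglongrightarrow> integral {0..t} (\<lambda>s. (t - s) * (V s * y s))"
    proof (rule dominated_convergence(2))
      show "(\<lambda>s. (t - s) * (V s * S N s)) integrable_on {0..t}" for N by (rule It[OF t contS])
      show "(\<lambda>s. k s * suminf M) integrable_on {0..t}"
        using integrable_on_set_integrable[OF kt[OF t]] by (rule integrable_on_mult_left)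
      show "norm ((t - s) * (V s * S N s)) \<le> k s * suminf M" if s: "s \<in> {0..t}" for N s
      proof -
        have "norm ((t - s) * (V s * S N s)) = (t - s) * (k s * \<bar>S N s\<bar>)"
          using s by (simp add: abs_mult k_def)
        also have "\<dots> \<le> 1 * (k s * suminf M)"
          using s t Sb[of s N] by (intro mult_mono mult_nonneg_nonneg) (auto simp: k_def)
        finally show ?thesis by simp
      qed
      show "(\<lambda>N. (t - s) * (V s * S N s)) \<longlonglongrightarrow> (t - s) * (V s * y s)" if "s \<in> {0..t}" for s
        by (intro tendsto_intros lim) (use that t in auto)
    qed
    then have "(\<lambda>N. S (Suc N) t) \<longlonglongrightarrow> t + integral {0..t} (\<lambda>s. (t - s) * (V s * y s))"
      unfolding step by (intro tendsto_intros)
    moreover have "(\<lambda>N. S (Suc N) t) \<longlonglongrightarrow> y t" by (rule LIMSEQ_Suc[OF lim[OF t]])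
    ultimately show ?thesis using LIMSEQ_unique by blast
  qed
  \<comment> \<open>Undoing the double primitive: the limit \<open>y\<close> is \<open>t\<close>
    plus the primitive of the continuous function \<open>F\<close>, so it is differentiable at every
    point with derivative \<open>1 + F\<close>.\<close>
  define F where "F t = integral {0..t} (\<lambda>s. V s * y s)" for t
  have contF: "continuous_on {0..1} F"
    unfolding F_def by (rule continuous_on_primitive[OF Vt[OF _ conty]]) simp
  have yF: "y t = t + integral {0..t} F" if "t \<in> {0..1}" for t
    unfolding F_def using eq[OF that] integral_double_primitive[OF Vt[OF that conty]] that by simp
  have "is_sol V y (\<lambda>t. 1 + F t)"
    unfolding is_sol_def
  proof (intro conjI ballI)
    show "y 0 = 0" using yF[of 0] by simp
    show "1 + F 0 = 1" by (simp add: F_def)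
    fix t :: real assume t: "t \<in> {0..1}"
    show i: "set_integrable lborel {0..t} (\<lambda>s. V s * y s)" by (rule Vt[OF t conty])
    show "1 + F t = 1 + (LINT s:{0..t}|lborel. V s * y s)"
      by (simp add: F_def LINT_eq_integral[OF i])
    have "((\<lambda>u. u + integral {0..u} F) has_real_derivative 1 + F t) (at t within {0..1})"
      by (intro DERIV_add DERIV_ident integral_has_real_derivative[OF contF t])
    then show "(y has_real_derivative 1 + F t) (at t within {0..1})"
      by (rule has_field_derivative_transform_within[where d=1]) (use t yF in auto)
  qed
  then show ?thesis by blast
qed

text \<open>Uniqueness makes the definite description in \<open>det_T\<close> meaningful, so the
  value at 1 of any one solution determines it.\<close>

lemma det_T_eq:
  assumes V: "set_integrable lborel {0..1} V" and s: "is_sol V y y'"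
  shows "det_T V = 2 * y 1"
  unfolding det_T_def
proof (rule the_equality)
  fix d assume "\<exists>y y'. is_sol V y y' \<and> d = 2 * y 1"
  then show "d = 2 * y 1" using is_sol_unique[OF V _ s, of _ _ 1] by auto
qed (use s in blast)

subsection \<open>The solution for the pulse\<close>

text \<open>The fundamental theorem of calculus tolerates finitely many exceptional points, so
  \<open>f\<close> is a primitive of \<open>g\<close>; continuity of \<open>g\<close> then supplies
  the derivative at those points too. This serves at the jumps of the pulse and at the ends of the
  interval.\<close>

lemma DERIV_within_finite_exceptions:
  fixes f g :: "real \<Rightarrow> real"
  assumes S: "finite S" and f: "continuous_on {a..b} f" and g: "continuous_on {a..b} g"
    and D: "\<And>x. x \<in> {a<..<b} - S \<Longrightarrow> (f has_real_derivative g x) (at x)"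
    and t: "t \<in> {a..b}"
  shows "(f has_real_derivative g t) (at t within {a..b})"
proof -
  have eq: "f x = f a + integral {a..x} g" if x: "x \<in> {a..b}" for x
  proof -
    have "(g has_integral f x - f a) {a..x}"
      by (rule fundamental_theorem_of_calculus_interior_strong[OF S])
        (use x D in \<open>auto simp: has_real_derivative_iff_has_vector_derivative[symmetric] intro: continuous_on_subset[OF f]\<close>)
    then show ?thesis by (simp add: has_integral_iff)
  qed
  have "((\<lambda>x. f a + integral {a..x} g) has_real_derivative 0 + g t) (at t within {a..b})"
    by (intro DERIV_add DERIV_const integral_has_real_derivative[OF g t])
  then have "(f has_real_derivative 0 + g t) (at t within {a..b})"
    by (rule has_field_derivative_transform_within[where d=1]) (use t in \<open>auto simp: eq[symmetric]\<close>)
  then show ?thesis by simp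
qed

lemma set_integrable_indicator_Icc:
  fixes a b c d k :: real
  shows "set_integrable lborel {a..b} (\<lambda>x. k * indicator {c..d} x)"
proof -
  have "integrable lborel (\<lambda>x. k * indicator ({a..b} \<inter> {c..d}) x :: real)"
    by (intro integrable_mult_right integrable_real_indicator) (auto simp: emeasure_lborel_Icc_eq)
  moreover have "(\<lambda>x. k * indicator ({a..b} \<inter> {c..d}) x) = (\<lambda>x. indicator {a..b} x *\<^sub>R (k * indicator {c..d} x))"
    by (auto simp: indicator_def fun_eq_iff)
  ultimately show ?thesis
    unfolding set_integrable_def by metis
qed

text \<open>The solution is \<open>t\<close> up to \<open>1/h\<close>, then
  \<open>exp (h * t - 1) / h\<close> on the pulse, then affine. The pulse starts exactly where
  \<open>y' / y = 1 / t\<close> has come down to \<open>h\<close>, so on the pulse only the growing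
  exponential occurs.\<close>

lemma is_sol_pulse:
  fixes h :: real
  assumes h: "2 < h"
  shows "\<exists>y y'. is_sol (\<lambda>x. h\<^sup>2 * indicator {1/h..1 - 1/h} x) y y' \<and> y 1 = 2 / h * exp (h - 2)"
proof -
  let ?P = "\<lambda>x. h\<^sup>2 * indicator {1/h..1 - 1/h} x :: real"
  let ?S = "{1/h, 1 - 1/h}"
  \<comment> \<open>Clamping \<open>t\<close> to the support of the pulse puts the three pieces into
    one formula, whose continuity across the joints is then automatic.\<close>
  define c where "c t = max (1/h) (min (1 - 1/h) t)" for t
  define y where "y t = (1/h) * exp (h * c t - 1) * (1 + h * (t - c t))" for t
  define y' where "y' t = exp (h * c t - 1)" for t
  have h0: "0 < h" "1/h < 1 - 1/h" "0 < 1/h" using h by (auto simp: field_simps)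
  have cc: "continuous_on X c" for X unfolding c_def by (intro continuous_intros)
  have cy: "continuous_on X y" for X unfolding y_def by (intro continuous_intros cc)
  have cy': "continuous_on X y'" for X unfolding y'_def by (intro continuous_intros cc)
  have D: "(y has_real_derivative y' x) (at x)" "(y' has_real_derivative ?P x * y x) (at x)" if x: "x \<notin> ?S" for x
  proof -
    consider "x < 1/h" | "1/h < x" "x < 1 - 1/h" | "1 - 1/h < x" using x by force
    then have "(y has_real_derivative y' x) (at x) \<and> (y' has_real_derivative ?P x * y x) (at x)"
    proof cases
      case 1
      have cx: "c t = 1/h" if "t \<in> {..<1/h}" for t using that h0 by (auto simp: c_def)
      have "((\<lambda>t. t) has_real_derivative y' x) (at x)"
        using 1 h0 by (auto intro!: derivative_eq_intros simp: y'_def cx)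
      then have "(y has_real_derivative y' x) (at x)"
        by (rule has_field_derivative_transform_within_open[of _ _ _ "{..<1/h}"])
          (use 1 h0 in \<open>auto simp: y_def cx field_simps\<close>)
      moreover have "((\<lambda>t. 1) has_real_derivative ?P x * y x) (at x)"
        using 1 by (auto intro!: derivative_eq_intros)
      then have "(y' has_real_derivative ?P x * y x) (at x)"
        by (rule has_field_derivative_transform_within_open[of _ _ _ "{..<1/h}"])
          (use 1 h0 in \<open>auto simp: y'_def cx\<close>)
      ultimately show ?thesis ..
    next
      case 2
      have cx: "c t = t" if "t \<in> {1/h<..<1 - 1/h}" for t using that h0 by (auto simp: c_def)
      have "((\<lambda>t. (1/h) * exp (h * t - 1)) has_real_derivative y' x) (at x)"
        using 2 h0 by (auto intro!: derivative_eq_intros simp: y'_def cx)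
      then have "(y has_real_derivative y' x) (at x)"
        by (rule has_field_derivative_transform_within_open[of _ _ _ "{1/h<..<1 - 1/h}"])
          (use 2 h0 in \<open>auto simp: y_def cx\<close>)
      moreover have "((\<lambda>t. exp (h * t - 1)) has_real_derivative ?P x * y x) (at x)"
        using 2 h0 by (auto intro!: derivative_eq_intros simp: y_def cx power2_eq_square)
      then have "(y' has_real_derivative ?P x * y x) (at x)"
        by (rule has_field_derivative_transform_within_open[of _ _ _ "{1/h<..<1 - 1/h}"])
          (use 2 h0 in \<open>auto simp: y'_def cx\<close>)
      ultimately show ?thesis ..
    next
      case 3
      have cx: "c t = 1 - 1/h" if "t \<in> {1 - 1/h<..}" for t using that h0 by (auto simp: c_def)
      have "((\<lambda>t. (1/h) * exp (h * (1 - 1/h) - 1) * (1 + h * (t - (1 - 1/h)))) has_real_derivative y' x) (at x)"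
        using 3 h0 by (auto intro!: derivative_eq_intros simp: y'_def cx)
      then have "(y has_real_derivative y' x) (at x)"
        by (rule has_field_derivative_transform_within_open[of _ _ _ "{1 - 1/h<..}"])
          (use 3 h0 in \<open>auto simp: y_def cx\<close>)
      moreover have "((\<lambda>t. exp (h * (1 - 1/h) - 1)) has_real_derivative ?P x * y x) (at x)"
        using 3 by (auto intro!: derivative_eq_intros)
      then have "(y' has_real_derivative ?P x * y x) (at x)"
        by (rule has_field_derivative_transform_within_open[of _ _ _ "{1 - 1/h<..}"])
          (use 3 h0 in \<open>auto simp: y'_def cx\<close>)
      ultimately show ?thesis ..
    qed
    then show "(y has_real_derivative y' x) (at x)" "(y' has_real_derivative ?P x * y x) (at x)" by auto
  qed
  have c0: "c 0 = 1/h" and c1: "c 1 = 1 - 1/h" using h0 by (auto simp: c_def)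
  have "is_sol ?P y y'"
    unfolding is_sol_def
  proof (intro conjI ballI)
    show "y 0 = 0" "y' 0 = 1" using h0 by (auto simp: y_def y'_def c0)
    fix t :: real assume t: "t \<in> {0..1}"
    show "(y has_real_derivative y' t) (at t within {0..1})"
      by (rule DERIV_within_finite_exceptions[of ?S]) (use D cy cy' t in auto)
    show i: "set_integrable lborel {0..t} (\<lambda>s. ?P s * y s)"
      by (intro set_integrable_mult_continuous set_integrable_indicator_Icc cy)
    have "((\<lambda>s. ?P s * y s) has_integral y' t - y' 0) {0..t}"
      by (rule fundamental_theorem_of_calculus_interior_strong[of ?S])
        (use t D(2) cy' in \<open>auto simp: has_real_derivative_iff_has_vector_derivative[symmetric]\<close>)
    then show "y' t = 1 + (LINT s:{0..t}|lborel. ?P s * y s)"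
      using LINT_eq_integral[OF i] \<open>y' 0 = 1\<close> by (simp add: has_integral_iff)
  qed
  moreover have "y 1 = 2 / h * exp (h - 2)"
    using h0 by (simp add: y_def c1 right_diff_distrib)
  ultimately show ?thesis by blast
qed

subsection \<open>The Riccati identity\<close>

lemma is_sol_deriv_diff:
  assumes V: "set_integrable lborel {0..1} V" and s: "is_sol V y y'"
    and ab: "0 \<le> a" "a \<le> b" "b \<le> 1"
  shows "integral {a..b} (\<lambda>s. V s * y s) = y' b - y' a"
proof -
  note Y = is_sol_unfold[OF V s]
  have "integral {0..a} (\<lambda>s. V s * y s) + integral {a..b} (\<lambda>s. V s * y s) = integral {0..b} (\<lambda>s. V s * y s)"
    by (rule Henstock_Kurzweil_Integration.integral_combine)
      (use ab in \<open>auto intro!: integrable_on_set_integrable set_integrable_Icc_subset[OF Y(3)]\<close>)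
  then show ?thesis using Y(4)[of a] Y(4)[of b] ab by simp
qed

text \<open>With \<open>p = y' / y\<close>, the formal derivative of \<open>ln y + q * p - C\<close>
  is \<open>p + q' * p + q * (V - p\<^sup>2) - q * r\<^sup>2\<close>; substituting
  \<open>1 + q' = 2 * q * r\<close> completes the square. The interval is kept general because
  \<open>q\<close>, \<open>r\<close> and \<open>C\<close> have different formulas on the three
  pieces.\<close>

lemma riccati_identity:
  assumes V: "set_integrable lborel {0..1} V" and s: "is_sol V y y'"
    and ab: "0 \<le> a" "a \<le> b" "b \<le> 1"
    and pos: "\<And>t. t \<in> {a..b} \<Longrightarrow> 0 < y t"
    and q: "\<And>t. t \<in> {a..b} \<Longrightarrow> (q has_real_derivative q' t) (at t within {a..b})"
    and q': "continuous_on {a..b} q'" and r: "continuous_on {a..b} r"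
    and C: "\<And>t. t \<in> {a..b} \<Longrightarrow> (C has_real_derivative q t * (r t)\<^sup>2) (at t within {a..b})"
    and qr: "\<And>t. t \<in> {a..b} \<Longrightarrow> 2 * q t * r t = 1 + q' t"
  shows "integral {a..b} (\<lambda>t. V t * q t) - integral {a..b} (\<lambda>t. q t * (y' t / y t - r t)\<^sup>2)
    = (ln (y b) + q b * (y' b / y b) - C b) - (ln (y a) + q a * (y' a / y a) - C a)"
proof -
  note Y = is_sol_unfold[OF V s]
  have sub: "{a..b} \<subseteq> {0..1}" using ab by auto
  have D: "(y has_real_derivative y' t) (at t within {a..b})" if "t \<in> {a..b}" for t
    using s that sub unfolding is_sol_def by (meson DERIV_subset subsetD)
  have cy: "continuous_on {a..b} y" and cy': "continuous_on {a..b} y'"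
    using Y(1,2) sub continuous_on_subset by blast+
  have cq: "continuous_on {a..b} q"
    using q DERIV_continuous continuous_on_eq_continuous_within by blast
  have y0: "\<And>t. t \<in> {a..b} \<Longrightarrow> y t \<noteq> 0" using pos by force
  \<comment> \<open>To avoid differentiating \<open>p\<close>, the product \<open>q * p\<close> is
    read as \<open>y' * (q / y)\<close>: the first factor is a primitive of \<open>V * y\<close>,
    and the second is continuously differentiable with derivative \<open>g\<close>.\<close>
  define g where "g t = (q' t * y t - q t * y' t) / (y t * y t)" for t
  have cg: "continuous_on {a..b} g"
    unfolding g_def by (intro continuous_intros cy cy' cq q') (use y0 in auto)
  have V': "set_integrable lborel {a..b} V"
    by (rule set_integrable_Icc_subset[OF V]) (use ab in auto)
  have Vy: "set_integrable lborel {a..b} (\<lambda>s. V s * y s)"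
    by (rule set_integrable_mult_continuous[OF V' cy])
  have Dqy: "((\<lambda>t. q t / y t) has_real_derivative g t) (at t within {a..b})" if "t \<in> {a..b}" for t
    unfolding g_def by (rule DERIV_divide[OF q[OF that] D[OF that] y0[OF that]])
  have 1: "integral {a..b} (\<lambda>t. (V t * y t) * (q t / y t) + y' t * g t) = y' b * (q b / y b) - y' a * (q a / y a)"
  proof (rule integral_parts_primitive[OF Vy borel_integrable_atLeastAtMost'[OF cg] ab(2)])
    fix t assume t: "t \<in> {a..b}"
    show "y' t = y' a + integral {a..t} (\<lambda>t. V t * y t)"
      using is_sol_deriv_diff[OF V s, of a t] t ab by simp
    have "(g has_integral q t / y t - q a / y a) {a..t}"
    proof (rule fundamental_theorem_of_calculus)
      fix x assume "x \<in> {a..t}"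
      then show "((\<lambda>t. q t / y t) has_vector_derivative g x) (at x within {a..t})"
        unfolding has_real_derivative_iff_has_vector_derivative[symmetric]
        using t by (intro DERIV_subset[OF Dqy]) auto
    qed (use t in auto)
    then show "q t / y t = q a / y a + integral {a..t} g" by (simp add: has_integral_iff)
  qed
  \<comment> \<open>The other part, \<open>ln y - C\<close>, is differentiable in the classical
    sense and needs only the ordinary fundamental theorem.\<close>
  have 2: "((\<lambda>t. y' t / y t - q t * (r t)\<^sup>2) has_integral (ln (y b) - C b) - (ln (y a) - C a)) {a..b}"
  proof (rule fundamental_theorem_of_calculus[OF ab(2)])
    fix x assume x: "x \<in> {a..b}"
    have "((\<lambda>x. ln (y x)) has_real_derivative 1 / y x * y' x) (at x within {a..b})"
      by (rule DERIV_chain2[OF DERIV_ln_divide[OF pos[OF x]] D[OF x]])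
    then show "((\<lambda>t. ln (y t) - C t) has_vector_derivative y' x / y x - q x * (r x)\<^sup>2) (at x within {a..b})"
      unfolding has_real_derivative_iff_has_vector_derivative[symmetric]
      using DERIV_diff[OF _ C[OF x]] by fastforce
  qed
  have i1: "(\<lambda>t. (V t * y t) * (q t / y t) + y' t * g t) integrable_on {a..b}"
    by (intro integrable_add integrable_on_set_integrable set_integrable_mult_continuous Vy
        borel_integrable_atLeastAtMost' continuous_intros cy cy' cq cg) (use y0 in auto)
  have i2: "(\<lambda>t. V t * q t) integrable_on {a..b}"
    by (intro integrable_on_set_integrable set_integrable_mult_continuous V' cq)
  have i3: "(\<lambda>t. q t * (y' t / y t - r t)\<^sup>2) integrable_on {a..b}"
    by (intro integrable_continuous_interval continuous_intros cy cy' cq r) (use y0 in auto)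
  have "integral {a..b} (\<lambda>t. V t * q t) - integral {a..b} (\<lambda>t. q t * (y' t / y t - r t)\<^sup>2)
    = integral {a..b} (\<lambda>t. V t * q t - q t * (y' t / y t - r t)\<^sup>2)"
    by (rule Henstock_Kurzweil_Integration.integral_diff[OF i2 i3, symmetric])
  also have "\<dots> = integral {a..b} (\<lambda>t. ((V t * y t) * (q t / y t) + y' t * g t) + (y' t / y t - q t * (r t)\<^sup>2))"
  proof (rule Henstock_Kurzweil_Integration.integral_cong)
    fix t assume t: "t \<in> {a..b}"
    define p where "p = y' t / y t"
    have yt: "y' t = p * y t" using y0[OF t] by (simp add: p_def)
    have gt: "y' t * g t = p * q' t - q t * p\<^sup>2"
      using y0[OF t] unfolding g_def yt by (simp add: field_simps power2_eq_square)
    have q't: "q' t = 2 * q t * r t - 1" using qr[OF t] by simp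
    show "V t * q t - q t * (y' t / y t - r t)\<^sup>2
      = ((V t * y t) * (q t / y t) + y' t * g t) + (y' t / y t - q t * (r t)\<^sup>2)"
      using y0[OF t] unfolding gt p_def[symmetric] q't by (simp add: power2_eq_square algebra_simps)
  qed
  also have "\<dots> = (y' b * (q b / y b) - y' a * (q a / y a)) + ((ln (y b) - C b) - (ln (y a) - C a))"
    using 1 2 by (subst Henstock_Kurzweil_Integration.integral_add[OF i1]) (auto simp: has_integral_iff)
  finally show ?thesis by (simp add: mult.commute)
qed

text \<open>The Riccati equation for \<open>r\<close> gives \<open>(r * y)' = v * y\<close>, while
  \<open>r * y = y'\<close> is also a primitive of \<open>V * y\<close>. Hence
  \<open>(V - v) * y\<close> has zero integral over every \<open>{t..b}\<close>, and positivity of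
  \<open>y\<close> allows division.\<close>

lemma AE_potential_eq_const:
  assumes V: "set_integrable lborel {0..1} V" and s: "is_sol V y y'"
    and ab: "0 \<le> a" "b \<le> 1"
    and pos: "\<And>t. t \<in> {a..b} \<Longrightarrow> 0 < y t"
    and ry: "\<And>t. t \<in> {a..b} \<Longrightarrow> y' t = r t * y t"
    and r: "\<And>t. t \<in> {a..b} \<Longrightarrow> (r has_real_derivative v - (r t)\<^sup>2) (at t within {a..b})"
  shows "AE x in lborel. x \<in> {a..b} \<longrightarrow> V x = v"
proof -
  note Y = is_sol_unfold[OF V s]
  have sub: "{a..b} \<subseteq> {0..1}" using ab by auto
  have cy: "continuous_on {a..b} y" using Y(1) sub continuous_on_subset by blast
  have D: "(y has_real_derivative y' t) (at t within {a..b})" if "t \<in> {a..b}" for t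
    using s that sub unfolding is_sol_def by (meson DERIV_subset subsetD)
  have V': "set_integrable lborel {a..b} V"
    by (rule set_integrable_Icc_subset[OF V]) (use ab in auto)
  have i: "set_integrable lborel {a..b} (\<lambda>x. V x * y x - v * y x)"
    by (intro set_integral_diff set_integrable_mult_continuous V' cy set_integrable_mult_right borel_integrable_atLeastAtMost')
  have "AE x in lborel. x \<in> {a..b} \<longrightarrow> V x * y x - v * y x = 0"
  proof (rule AE_zero_if_interval_integrals_zero[OF i])
    fix t assume t: "t \<in> {a..b}"
    have 1: "((\<lambda>x. v * y x) has_integral r b * y b - r t * y t) {t..b}"
    proof (rule fundamental_theorem_of_calculus)
      fix x assume x: "x \<in> {t..b}"
      then have x': "x \<in> {a..b}" using t by auto
      have "((\<lambda>t. r t * y t) has_real_derivative v * y x) (at x within {a..b})"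
        using DERIV_mult[OF r[OF x'] D[OF x']] ry[OF x'] by (simp add: power2_eq_square algebra_simps)
      then show "((\<lambda>t. r t * y t) has_vector_derivative v * y x) (at x within {t..b})"
        unfolding has_real_derivative_iff_has_vector_derivative[symmetric]
        by (rule DERIV_subset) (use t in auto)
    qed (use t in auto)
    have "(\<lambda>s. V s * y s) integrable_on {t..b}"
      by (rule integrable_on_set_integrable[OF set_integrable_Icc_subset[OF Y(3)]]) (use t ab in auto)
    then have 2: "((\<lambda>s. V s * y s) has_integral r b * y b - r t * y t) {t..b}"
      using is_sol_deriv_diff[OF V s, of t b] t ab ry[of b] ry[of t] by (simp add: has_integral_iff)
    show "integral {t..b} (\<lambda>x. V x * y x - v * y x) = 0"
      using integral_unique[OF has_integral_diff[OF 2 1]] by simp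
  qed
  then show ?thesis
    by eventually_elim (use pos in force)
qed

subsection \<open>The sharp bound\<close>

text \<open>At 0 both \<open>ln y\<close> and \<open>ln e\<close> diverge and \<open>y' / y\<close>
  blows up, so the boundary term of the Riccati identity exists only as a limit. The
  differentiability of \<open>y\<close> at 0 with derivative 1 makes the logarithms cancel, and the
  product of \<open>q\<close> with \<open>y' / y\<close> tends to 1.\<close>

lemma is_sol_boundary_limit:
  fixes h :: real
  assumes V: "set_integrable lborel {0..1} V" and s: "is_sol V y y'"
    and pos: "\<And>t. t \<in> {0<..1} \<Longrightarrow> 0 < y t"
  shows "((\<lambda>e. ln (y e) + (e - h * e\<^sup>2 / 2) * (y' e / y e) - (ln e - h * e / 2)) \<longlongrightarrow> 1) (at_right 0)"
proof -
  note Y = is_sol_unfold[OF V s]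
  have w: "at 0 within {0..1} = at_right (0::real)" by (simp add: at_within_Icc_at_right)
  have y0: "y 0 = 0" "y' 0 = 1" and "\<forall>t\<in>{0..1}. (y has_real_derivative y' t) (at t within {0..1})"
    using s unfolding is_sol_def by blast+
  then have "(y has_real_derivative y' 0) (at 0 within {0..1})" by force
  with y0 have L: "((\<lambda>e. y e / e) \<longlongrightarrow> 1) (at_right 0)"
    by (simp add: has_field_derivative_iff w)
  have L': "(y' \<longlongrightarrow> 1) (at_right 0)"
    using Y(2) y0 w by (auto simp: continuous_on_def dest!: bspec[of _ _ 0])
  have id: "((\<lambda>e. e) \<longlongrightarrow> 0) (at_right (0::real))" by (rule tendsto_ident_at)
  \<comment> \<open>In terms of the quotient \<open>y e / e\<close>, which tends to 1, no singular
    term is left.\<close>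
  have "((\<lambda>e. ln (y e / e) + (1 - h * e / 2) * (y' e / (y e / e)) + h * e / 2) \<longlongrightarrow>
      ln 1 + (1 - h * 0 / 2) * (1 / 1) + h * 0 / 2) (at_right 0)"
    by (intro tendsto_intros L L' id) auto
  then have lim: "((\<lambda>e. ln (y e / e) + (1 - h * e / 2) * (y' e / (y e / e)) + h * e / 2) \<longlongrightarrow> 1) (at_right 0)"
    by simp
  have "eventually (\<lambda>e. e \<in> {0<..<1}) (at_right (0::real))"
    by (rule eventually_at_right_real) simp
  then have "eventually (\<lambda>e. ln (y e / e) + (1 - h * e / 2) * (y' e / (y e / e)) + h * e / 2
    = ln (y e) + (e - h * e\<^sup>2 / 2) * (y' e / y e) - (ln e - h * e / 2)) (at_right 0)"
  proof eventually_elim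
    case (elim e)
    then have "0 < y e" "0 < e" using pos by auto
    then show ?case by (simp add: ln_div field_simps power2_eq_square)
  qed
  with lim show ?thesis by (rule Lim_transform_eventually)
qed

text \<open>The Riccati identity is summed over the three pieces, with the squared defects kept on
  the left for the equality case. The boundary terms at the two joints cancel, and the bound on
  \<open>q\<close> limits the potential term to
  \<open>(h\<^sup>2 - 2 * h) / (2 * h) = (h - 2) / 2\<close>. The first defect starts at
  \<open>a > 0\<close> because \<open>1 / t\<close> is singular at 0.\<close>

lemma log_solution_bound:
  fixes h :: real
  assumes h: "2 < h" and V: "set_integrable lborel {0..1} V" and s: "is_sol V y y'"
    and V0: "\<And>t. t \<in> {0..1} \<Longrightarrow> 0 \<le> V t" and V1: "integral {0..1} V \<le> h\<^sup>2 - 2 * h"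
    and pos: "\<And>t. t \<in> {0<..1} \<Longrightarrow> 0 < y t" and a: "0 < a" "a \<le> 1/h"
  shows "ln (y 1) + integral {a..1/h} (\<lambda>t. (t - h * t\<^sup>2 / 2) * (y' t / y t - 1 / t)\<^sup>2)
     + integral {1/h..1 - 1/h} (\<lambda>t. 1 / (2 * h) * (y' t / y t - h)\<^sup>2)
     + integral {1 - 1/h..1} (\<lambda>t. ((1 - t) - h * (1 - t)\<^sup>2 / 2) * (y' t / y t - h / (2 - h * (1 - t)))\<^sup>2)
     \<le> ln (2 / h) + h - 2"
proof -
  note Y = is_sol_unfold[OF V s]
  let ?p = "\<lambda>t. y' t / y t"
  let ?qL = "\<lambda>t. t - h * t\<^sup>2 / 2" and ?qR = "\<lambda>t. (1 - t) - h * (1 - t)\<^sup>2 / 2" and ?rR = "\<lambda>t. h / (2 - h * (1 - t))"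
  let ?DL = "\<lambda>a. integral {a..1/h} (\<lambda>t. ?qL t * (?p t - 1 / t)\<^sup>2)"
  let ?DM = "integral {1/h..1 - 1/h} (\<lambda>t. 1 / (2 * h) * (?p t - h)\<^sup>2)"
  let ?DR = "integral {1 - 1/h..1} (\<lambda>t. ?qR t * (?p t - ?rR t)\<^sup>2)"
  let ?E = "\<lambda>e. ln (y e) + ?qL e * ?p e - (ln e - h * e / 2)"
  have h0: "0 < h" "1/h < 1 - 1/h" "0 < 1/h" "1 - 1/h < 1" using h by (auto simp: field_simps)
  have qL: "0 \<le> ?qL t" if "0 < t" "t \<le> 1/h" for t
  proof -
    have "h * t \<le> 1" using that h0 by (simp add: field_simps)
    then have "0 \<le> t * (1 - h * t / 2)" using that by simp
    then show ?thesis by (simp add: algebra_simps power2_eq_square)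
  qed
  \<comment> \<open>The gap is the square \<open>(h * t - 1)\<^sup>2 / (2 * h)\<close>. Since
    \<open>t\<close> is arbitrary, \<open>1 - t\<close> may be put in its place, which covers the
    right piece.\<close>
  have q_le: "t - h * t\<^sup>2 / 2 \<le> 1 / (2 * h)" for t
  proof -
    have "0 \<le> (h * t - 1)\<^sup>2 / (2 * h)" using h0 by simp
    also have "\<dots> = 1 / (2 * h) - (t - h * t\<^sup>2 / 2)" using h0 by (simp add: field_simps power2_eq_square)
    finally show ?thesis by simp
  qed
  have VI: "V integrable_on {c..d}" "(\<lambda>t. V t * q t) integrable_on {c..d}"
    if "0 \<le> c" "d \<le> 1" "continuous_on {c..d} q" for c d q
    by (intro integrable_on_set_integrable set_integrable_mult_continuous that set_integrable_Icc_subset[OF V])+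
  have Vq: "integral {c..d} (\<lambda>t. V t * q t) \<le> integral {c..d} V * (1 / (2 * h))"
    if "0 \<le> c" "d \<le> 1" "continuous_on {c..d} q" "\<And>t. q t \<le> 1 / (2 * h)" for c d q
  proof -
    have "integral {c..d} (\<lambda>t. V t * q t) \<le> integral {c..d} (\<lambda>t. V t * (1 / (2 * h)))"
    proof (rule integral_le)
      show "(\<lambda>t. V t * (1 / (2 * h))) integrable_on {c..d}" by (rule VI[OF that(1,2) continuous_on_const])
      show "V t * q t \<le> V t * (1 / (2 * h))" if "t \<in> {c..d}" for t
        using V0[of t] \<open>\<And>t. q t \<le> 1 / (2 * h)\<close> \<open>0 \<le> c\<close> \<open>d \<le> 1\<close> that by (intro mult_left_mono) auto
    qed (rule VI[OF that(1-3)])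
    then show ?thesis by simp
  qed
  \<comment> \<open>The identity is applied from \<open>e\<close> on and the left defect is then cut
    down to start at \<open>a\<close>; its integrand is non-negative, so this only weakens the
    inequality. The left side thereby becomes independent of \<open>e\<close>.\<close>
  have main: "ln (y 1) + ?DL a + ?DM + ?DR \<le> (ln (2 / h) + h - 3) + ?E e" if e: "0 < e" "e \<le> a" for e
  proof -
    have e1: "e \<le> 1 - 1/h" "e \<le> 1" using e a h0(2,3) by linarith+
    \<comment> \<open>On the left \<open>r = 1 / t\<close>, so
      \<open>q * r\<^sup>2 = 1 / t - h / 2\<close>, with primitive
      \<open>ln t - h * t / 2\<close>.\<close>
    have L: "integral {e..1/h} (\<lambda>t. V t * ?qL t) - ?DL e
      = (ln (y (1/h)) + ?qL (1/h) * ?p (1/h) - (ln (1/h) - h * (1/h) / 2)) - ?E e"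
    proof (rule riccati_identity[OF V s, where q' = "\<lambda>t. 1 - h * t"])
      fix t assume t: "t \<in> {e..1/h}"
      then have "0 < t" "t \<le> 1" using e h0(2,4) unfolding atLeastAtMost_iff by linarith+
      then show "0 < y t" using pos by simp
      show "(?qL has_real_derivative 1 - h * t) (at t within {e..1/h})"
        by (auto intro!: derivative_eq_intros)
      show "2 * ?qL t * (1 / t) = 1 + (1 - h * t)"
        using \<open>0 < t\<close> by (simp add: field_simps power2_eq_square)
      have "1 / t - h / 2 = ?qL t * (1 / t)\<^sup>2"
        using \<open>0 < t\<close> by (simp add: field_simps power2_eq_square)
      then show "((\<lambda>t. ln t - h * t / 2) has_real_derivative ?qL t * (1 / t)\<^sup>2) (at t within {e..1/h})"
        using \<open>0 < t\<close> by (auto intro!: derivative_eq_intros)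
    qed (use e a h0 in \<open>auto intro!: continuous_intros\<close>)
    \<comment> \<open>On the pulse \<open>q = 1 / (2 * h)\<close> and \<open>r = h\<close> are
      constant, so \<open>C\<close> is \<open>h / 2 * t\<close>.\<close>
    have M: "integral {1/h..1 - 1/h} (\<lambda>t. V t * (1 / (2 * h))) - ?DM
      = (ln (y (1 - 1/h)) + 1 / (2 * h) * ?p (1 - 1/h) - h / 2 * (1 - 1/h)) - (ln (y (1/h)) + 1 / (2 * h) * ?p (1/h) - h / 2 * (1/h))"
      by (rule riccati_identity[OF V s, where q' = "\<lambda>t. 0"])
        (use e a h0 pos in \<open>auto intro!: derivative_eq_intros continuous_intros simp: power2_eq_square\<close>)
    have rpos: "0 < 2 - h * (1 - t)" if "t \<in> {1 - 1/h..1}" for t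
    proof -
      have "h * (1 - t) \<le> h * (1 / h)" using that h0 by (intro mult_left_mono) auto
      then show ?thesis using h0 by simp
    qed
    \<comment> \<open>To the right of the pulse the extremal solution is a multiple of
      \<open>2 - h * (1 - t)\<close>, which gives \<open>r\<close>. Here
      \<open>q = (1 - t) * (2 - h * (1 - t)) / 2\<close>, so
      \<open>q * r\<^sup>2 = r - h / 2\<close>.\<close>
    have R: "integral {1 - 1/h..1} (\<lambda>t. V t * ?qR t) - ?DR
      = (ln (y 1) + ?qR 1 * ?p 1 - (ln (2 - h * (1 - 1)) - h * 1 / 2))
        - (ln (y (1 - 1/h)) + ?qR (1 - 1/h) * ?p (1 - 1/h) - (ln (2 - h * (1 - (1 - 1/h))) - h * (1 - 1/h) / 2))"
    proof (rule riccati_identity[OF V s, where q' = "\<lambda>t. -1 + h * (1 - t)"])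
      fix t assume t: "t \<in> {1 - 1/h..1}"
      note rp = rpos[OF t]
      show "(?qR has_real_derivative -1 + h * (1 - t)) (at t within {1 - 1/h..1})"
        by (auto intro!: derivative_eq_intros simp: power2_eq_square field_simps)
      have f: "?qR t = (1 - t) * (2 - h * (1 - t)) / 2" by (simp add: power2_eq_square field_simps)
      show "2 * ?qR t * ?rR t = 1 + (-1 + h * (1 - t))"
        unfolding f using rp by simp
      have "h / (2 - h * (1 - t)) - h / 2 = ?qR t * (?rR t)\<^sup>2"
        unfolding f using rp by (simp add: divide_simps power2_eq_square) (simp add: algebra_simps)
      then show "((\<lambda>t. ln (2 - h * (1 - t)) - h * t / 2) has_real_derivative ?qR t * (?rR t)\<^sup>2) (at t within {1 - 1/h..1})"
        using rp by (auto intro!: derivative_eq_intros)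
      have "t \<in> {0<..1}" using t h0(2-4) unfolding atLeastAtMost_iff greaterThanAtMost_iff by linarith
      then show "0 < y t" by (rule pos)
    next
      show "continuous_on {1 - 1/h..1} ?rR" using rpos by (intro continuous_intros) force
    qed (use h0 in \<open>auto intro!: continuous_intros\<close>)
    have mono: "?DL a \<le> ?DL e"
    proof (rule integral_subset_le)
      have "(\<lambda>t. ?qL t * (?p t - 1 / t)\<^sup>2) integrable_on {c..1/h}" if "0 < c" for c
      proof -
        have sub: "{c..1/h} \<subseteq> {0<..1}"
        proof
          fix t assume "t \<in> {c..1/h}"
          then show "t \<in> {0<..1}" using that h0(2,4) unfolding atLeastAtMost_iff greaterThanAtMost_iff by linarith
        qed
        then have "{c..1/h} \<subseteq> {0..1}" by fastforce
        then have "continuous_on {c..1/h} y" "continuous_on {c..1/h} y'"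
          using continuous_on_subset[OF Y(1)] continuous_on_subset[OF Y(2)] by blast+
        moreover have "\<forall>t\<in>{c..1/h}. y t \<noteq> 0" using pos sub by force
        ultimately show ?thesis
          using that by (intro integrable_continuous_interval continuous_intros) auto
      qed
      then show "(\<lambda>t. ?qL t * (?p t - 1 / t)\<^sup>2) integrable_on {a..1/h}" "(\<lambda>t. ?qL t * (?p t - 1 / t)\<^sup>2) integrable_on {e..1/h}"
        using e a by auto
      show "{a..1/h} \<subseteq> {e..1/h}" using e by auto
      show "\<forall>t\<in>{e..1/h}. 0 \<le> ?qL t * (?p t - 1 / t)\<^sup>2"
        using qL e by simp
    qed
    have "integral {e..1/h} (\<lambda>t. V t * ?qL t) + integral {1/h..1 - 1/h} (\<lambda>t. V t * (1 / (2 * h))) + integral {1 - 1/h..1} (\<lambda>t. V t * ?qR t)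
      \<le> integral {e..1/h} V * (1 / (2 * h)) + integral {1/h..1 - 1/h} V * (1 / (2 * h)) + integral {1 - 1/h..1} V * (1 / (2 * h))"
      by (intro add_mono Vq) (use e a h0 q_le in \<open>auto intro!: continuous_intros\<close>)
    also have "\<dots> = (integral {e..1/h} V + integral {1/h..1 - 1/h} V + integral {1 - 1/h..1} V) * (1 / (2 * h))"
      by (simp add: algebra_simps add_divide_distrib)
    also have "integral {e..1/h} V + integral {1/h..1 - 1/h} V = integral {e..1 - 1/h} V"
      by (rule Henstock_Kurzweil_Integration.integral_combine) (use e e1 a h0 in \<open>auto intro!: VI(1)[OF _ _ continuous_on_const]\<close>)
    also have "integral {e..1 - 1/h} V + integral {1 - 1/h..1} V = integral {e..1} V"
      by (rule Henstock_Kurzweil_Integration.integral_combine[OF e1(1)]) (use e h0 in \<open>auto intro!: VI(1)[OF _ _ continuous_on_const]\<close>)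
    also have "integral {e..1} V * (1 / (2 * h)) \<le> integral {0..1} V * (1 / (2 * h))"
      by (intro mult_right_mono integral_subset_le) (use e e1 a h0 V0 in \<open>auto intro!: VI(1)[OF _ _ continuous_on_const]\<close>)
    also have "\<dots> \<le> (h\<^sup>2 - 2 * h) * (1 / (2 * h))"
      using V1 h0 by (intro mult_right_mono) auto
    also have "\<dots> = (h - 2) / 2" using h0 by (simp add: field_simps power2_eq_square)
    finally have I: "integral {e..1/h} (\<lambda>t. V t * ?qL t) + integral {1/h..1 - 1/h} (\<lambda>t. V t * (1 / (2 * h)))
      + integral {1 - 1/h..1} (\<lambda>t. V t * ?qR t) \<le> (h - 2) / 2" .
    have v: "?qL (1/h) = 1 / (2 * h)" "?qR 1 = 0" "?qR (1 - 1/h) = 1 / (2 * h)" "h * (1/h) / 2 = 1/2"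
       "2 - h * (1 - (1 - 1/h)) = 1" "2 - h * (1 - 1) = 2" "h * (1 - 1/h) / 2 = h/2 - 1/2" "h / 2 * (1 - 1/h) = h/2 - 1/2" "h / 2 * (1/h) = 1/2"
      using h0 by (auto simp: field_simps power2_eq_square)
    have l: "ln (1/h) = - ln h" "ln (2/h) = ln 2 - ln h" using h0 by (auto simp: ln_div)
    \<comment> \<open>The remaining step is linear arithmetic with all integrals and logarithms
      abstracted to variables. \<open>Lm\<close> and \<open>Ln\<close> stand for
      \<open>ln y + q * p\<close> at the two joints and drop out.\<close>
    have sum: "y1 + DLa + DM + DR \<le> (l2 - lh + h - 3) + E"
      if "IL + IM + IR \<le> (h - 2) / 2" "DLa \<le> DL" "IL - DL = (Lm - (- lh - 1/2)) - E"
        "IM - DM = (Ln - (h/2 - 1/2)) - (Lm - 1/2)"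
        "IR - DR = (y1 + 0 * p - (l2 - h * 1 / 2)) - (Ln - (0 - (h/2 - 1/2)))"
      for IL IM IR DL DLa DM DR Lm Ln y1 E l2 lh p :: real
      using that by (simp add: field_simps)
    show ?thesis
      unfolding l by (rule sum[OF I mono L[unfolded v l] M[unfolded v] R[unfolded v ln_one]])
  qed
  \<comment> \<open>Letting \<open>e\<close> tend to 0 from the right, the boundary term contributes
    1 and turns \<open>h - 3\<close> into \<open>h - 2\<close>.\<close>
  have "((\<lambda>e. (ln (2 / h) + h - 3) + ?E e) \<longlongrightarrow> (ln (2 / h) + h - 3) + 1) (at_right 0)"
    by (intro tendsto_intros is_sol_boundary_limit[OF V s pos])
  moreover have "eventually (\<lambda>e. ln (y 1) + ?DL a + ?DM + ?DR \<le> (ln (2 / h) + h - 3) + ?E e) (at_right 0)"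
    using eventually_at_right_real[OF a(1)] by eventually_elim (rule main, auto)
  ultimately have "ln (y 1) + ?DL a + ?DM + ?DR \<le> (ln (2 / h) + h - 3) + 1"
    by (intro tendsto_lowerbound) auto
  then show ?thesis by simp
qed

text \<open>Comparison with the zero potential, whose solution is \<open>t\<close>. It supplies the
  positivity of \<open>y\<close> on \<open>{0<..1}\<close> on which the logarithmic derivative
  depends.\<close>

lemma is_sol_ge_id:
  assumes V: "set_integrable lborel {0..1} V" and s: "is_sol V y y'"
    and V0: "\<And>t. t \<in> {0..1} \<Longrightarrow> 0 \<le> V t" and t: "t \<in> {0..1}"
  shows "t \<le> y t"
proof -
  have "set_integrable lborel {0..1} (\<lambda>_. 0 :: real)" by (simp add: set_integrable_def)
  moreover have "is_sol (\<lambda>_. 0) (\<lambda>t. t) (\<lambda>_. 1)"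
    by (auto simp: is_sol_def set_integrable_def set_lebesgue_integral_def)
  ultimately have "\<bar>t\<bar> \<le> y t"
    by (rule is_sol_compare[OF _ _ V s _ t]) (use V0 in auto)
  then show ?thesis by simp
qed

text \<open>All three defects are non-negative, which gives the bound. In the equality case each of
  them vanishes, and wherever \<open>q > 0\<close> continuity forces \<open>y' / y = r\<close>; the
  Riccati equation for \<open>r\<close> then determines \<open>V\<close> piece by piece.\<close>

lemma nonneg_potential_bound:
  fixes h :: real
  assumes h: "2 < h" and V: "set_integrable lborel {0..1} V" and s: "is_sol V y y'"
    and V0: "\<And>t. t \<in> {0..1} \<Longrightarrow> 0 \<le> V t" and V1: "integral {0..1} V \<le> h\<^sup>2 - 2 * h"
  shows "y 1 \<le> 2 / h * exp (h - 2)"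
    and "y 1 = 2 / h * exp (h - 2) \<Longrightarrow>
      AE x in lborel. x \<in> {0..1} \<longrightarrow> V x = h\<^sup>2 * indicator {1/h..1 - 1/h} x"
proof -
  note Y = is_sol_unfold[OF V s]
  have pos: "0 < y t" if "t \<in> {0<..1}" for t
    using is_sol_ge_id[OF V s V0, of t] that by auto
  define m where "m = 1 / h"
  have m: "0 < m" "m < 1 - m" "h * m = 1" "0 < h" using h by (auto simp: m_def field_simps)
  let ?p = "\<lambda>t. y' t / y t"
  let ?fL = "\<lambda>t. (t - h * t\<^sup>2 / 2) * (?p t - 1 / t)\<^sup>2"
  let ?fM = "\<lambda>t. 1 / (2 * h) * (?p t - h)\<^sup>2"
  let ?fR = "\<lambda>t. ((1 - t) - h * (1 - t)\<^sup>2 / 2) * (?p t - h / (2 - h * (1 - t)))\<^sup>2"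
  have bound: "ln (y 1) + integral {a..m} ?fL + integral {m..1 - m} ?fM + integral {1 - m..1} ?fR \<le> ln (2 / h) + h - 2"
    if "0 < a" "a \<le> m" for a
    using log_solution_bound[OF h V s V0 V1 pos, of a] that unfolding m_def by blast
  have qpos: "0 < t - h * t\<^sup>2 / 2" if "0 < t" "t \<le> m" for t
  proof -
    have "h * t \<le> h * m" using that m by (intro mult_left_mono) auto
    then have "0 < t * (1 - h * t / 2)" using that m(3) by simp
    then show ?thesis by (simp add: algebra_simps power2_eq_square)
  qed
  have rpos: "0 < 2 - h * (1 - t)" if "1 - m \<le> t" for t
  proof -
    have "h * (1 - t) \<le> h * m" using that m by (intro mult_left_mono) auto
    then show ?thesis using m by simp
  qed
  have c: "continuous_on {a..b} y" "continuous_on {a..b} y'" "\<forall>t\<in>{a..b}. y t \<noteq> 0" if "0 < a" "b \<le> 1" for a b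
  proof -
    have sub: "{a..b} \<subseteq> {0..1}" "{a..b} \<subseteq> {0<..1}" using that by auto
    show "continuous_on {a..b} y" "continuous_on {a..b} y'"
      using continuous_on_subset[OF _ sub(1)] Y(1,2) by blast+
    show "\<forall>t\<in>{a..b}. y t \<noteq> 0"
    proof
      fix t assume "t \<in> {a..b}"
      then have "0 < y t" using pos sub(2) by blast
      then show "y t \<noteq> 0" by simp
    qed
  qed
  have cL: "continuous_on {a..m} ?fL" if "0 < a" for a
    using c[of a m] that m by (intro continuous_intros) auto
  have cM: "continuous_on {m..1 - m} ?fM"
    using c[of m "1 - m"] m by (intro continuous_intros) auto
  have cR: "continuous_on {1 - m..1} ?fR"
    using c[of "1 - m" 1] m rpos by (intro continuous_intros) force+
  have fL: "0 \<le> ?fL t" if "t \<in> {a..m}" "0 < a" for a t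
    using qpos[of t] that by (intro mult_nonneg_nonneg) auto
  have fM: "0 \<le> ?fM t" for t using m by simp
  have fR: "0 \<le> ?fR t" if "t \<in> {1 - m..1}" for t
    using qpos[of "1 - t"] that by (cases "t = 1") (auto intro!: mult_nonneg_nonneg)
  have I0: "0 \<le> integral {a..m} ?fL" if "0 < a" for a
    by (rule integral_nonneg[OF integrable_continuous_interval[OF cL[OF that]]]) (use fL that in blast)
  have I1: "0 \<le> integral {m..1 - m} ?fM"
    by (rule integral_nonneg[OF integrable_continuous_interval[OF cM]]) (rule fM)
  have I2: "0 \<le> integral {1 - m..1} ?fR"
    by (rule integral_nonneg[OF integrable_continuous_interval[OF cR]]) (rule fR)
  have y1: "0 < y 1" using pos by simp
  have ln_eq: "ln (2 / h * exp (h - 2)) = ln (2 / h) + h - 2"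
    using m(4) ln_mult[of "2 / h" "exp (h - 2)"] by (simp only: ln_exp) simp
  have "ln (y 1) \<le> ln (2 / h * exp (h - 2))"
    using bound[OF m(1) order_refl] I0[OF m(1)] I1 I2 unfolding ln_eq by linarith
  then show "y 1 \<le> 2 / h * exp (h - 2)"
    using y1 m(4) by (subst (asm) ln_le_cancel_iff) auto
  assume eq: "y 1 = 2 / h * exp (h - 2)"
  have Z: "integral {a..m} ?fL = 0 \<and> integral {m..1 - m} ?fM = 0 \<and> integral {1 - m..1} ?fR = 0"
    if "0 < a" "a \<le> m" for a
  proof -
    have "ln (y 1) = ln (2 / h) + h - 2" using ln_eq unfolding eq .
    then show ?thesis using bound[OF that] I0[OF that(1)] I1 I2 by linarith
  qed
  \<comment> \<open>The left end stays away from 0, where \<open>1 / t\<close> is singular and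
    \<open>q\<close> vanishes.\<close>
  have AL: "AE x in lborel. x \<in> {a..m} \<longrightarrow> V x = 0" if a: "0 < a" "a < m" for a
  proof (rule AE_potential_eq_const[OF V s, where r = "\<lambda>t. 1 / t"])
    fix t assume t: "t \<in> {a..m}"
    then show "0 < y t" using pos a m by auto
    have "?fL t = 0"
      using integral_eq_0_iff[OF cL[OF a(1)] a(2) fL[OF _ a(1)]] Z[of a] a t by auto
    then have "?p t = 1 / t" using qpos[of t] t a by auto
    then show "y' t = 1 / t * y t" using \<open>0 < y t\<close> by (simp add: field_simps)
    show "((\<lambda>t. 1 / t) has_real_derivative 0 - (1 / t)\<^sup>2) (at t within {a..m})"
      using t a by (auto intro!: derivative_eq_intros simp: power2_eq_square)
  qed (use a m in auto)
  have AM: "AE x in lborel. x \<in> {m..1 - m} \<longrightarrow> V x = h\<^sup>2"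
  proof (rule AE_potential_eq_const[OF V s, where r = "\<lambda>t. h"])
    fix t assume t: "t \<in> {m..1 - m}"
    then show "0 < y t" using pos m by auto
    have "?fM t = 0"
      using integral_eq_0_iff[OF cM m(2) fM] Z[OF m(1) order_refl] t by auto
    then have "?p t = h" using m by simp
    then show "y' t = h * y t" using \<open>0 < y t\<close> by (simp add: field_simps)
    show "((\<lambda>t. h) has_real_derivative h\<^sup>2 - h\<^sup>2) (at t within {m..1 - m})" by simp
  qed (use m in auto)
  \<comment> \<open>The right end stays away from 1: \<open>q\<close> vanishes there, so the
    vanishing integrand says nothing about \<open>y' / y\<close> at that point.\<close>
  have AR: "AE x in lborel. x \<in> {1 - m..1 - a} \<longrightarrow> V x = 0" if a: "0 < a" "a < m" for a
  proof (rule AE_potential_eq_const[OF V s, where r = "\<lambda>t. h / (2 - h * (1 - t))"])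
    fix t assume t: "t \<in> {1 - m..1 - a}"
    then show "0 < y t" using pos a m by auto
    have "?fR t = 0"
      using integral_eq_0_iff[OF cR _ fR] Z[OF m(1) order_refl] t a m by auto
    then have "?p t = h / (2 - h * (1 - t))" using qpos[of "1 - t"] t a by auto
    then show "y' t = h / (2 - h * (1 - t)) * y t" using \<open>0 < y t\<close> by (simp add: field_simps)
    have "0 < 2 - h * (1 - t)" using rpos t by simp
    then show "((\<lambda>t. h / (2 - h * (1 - t))) has_real_derivative 0 - (h / (2 - h * (1 - t)))\<^sup>2) (at t within {1 - m..1 - a})"
      by (auto intro!: derivative_eq_intros simp: power2_eq_square)
  qed (use a m in auto)
  \<comment> \<open>A sequence decreasing to 0 exhausts the two open ends by countably many closed
    intervals, so the exceptional sets still form a null set. The shift by 2 keeps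
    \<open>e 0\<close> strictly below \<open>m\<close>.\<close>
  define e where "e n = m / real (n + 2)" for n :: nat
  have e: "0 < e n" "e n < m" for n
    using m(1) mult_strict_left_mono[of 1 "real (n + 2)" m] by (simp_all add: e_def divide_less_eq)
  have elim: "e \<longlonglongrightarrow> 0"
    unfolding e_def by (rule LIMSEQ_ignore_initial_segment[OF lim_const_over_n])
  have "AE x in lborel. \<forall>n. (x \<in> {e n..m} \<longrightarrow> V x = 0) \<and> (x \<in> {1 - m..1 - e n} \<longrightarrow> V x = 0)"
    unfolding AE_all_countable AE_conj_iff using AL AR e by blast
  moreover have "AE x in lborel. x \<noteq> 0 \<and> x \<noteq> m \<and> x \<noteq> 1 - m \<and> x \<noteq> 1"
    unfolding AE_conj_iff by (intro conjI AE_lborel_singleton)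
  ultimately show "AE x in lborel. x \<in> {0..1} \<longrightarrow> V x = h\<^sup>2 * indicator {1/h..1 - 1/h} x"
    unfolding m_def[symmetric] using AM
  proof eventually_elim
    case (elim x)
    show ?case
    proof
      assume x: "x \<in> {0..1}"
      have "0 < min x (1 - x)" using x elim by auto
      then obtain n where n: "e n < min x (1 - x)"
        using order_tendstoD(2)[OF \<open>e \<longlonglongrightarrow> 0\<close>] by (metis eventually_sequentially order_refl)
      then have z: "x < m \<Longrightarrow> V x = 0" "1 - m < x \<Longrightarrow> V x = 0"
        using spec[OF elim(1), of n] by auto
      consider "x < m" | "m < x" "x < 1 - m" | "1 - m < x" using elim by force
      then show "V x = h\<^sup>2 * indicator {m..1 - m} x"
      proof cases
        case 1
        then show ?thesis using z(1) by simp
      next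
        case 2
        then show ?thesis using elim(3) by simp
      next
        case 3
        then show ?thesis using z(2) by simp
      qed
    qed
  qed
qed

section \<open>Reduction of signed potentials to non-negative ones\<close>

text \<open>Replacing \<open>V\<close> by \<open>\<bar>V\<bar>\<close> keeps the norm and can only
  raise the value at 1. In the equality case both solutions agree at 1, and the Volterra equations
  express their difference there as the integral of a non-negative function, which must vanish
  almost everywhere.\<close>

lemma potential_bound:
  fixes h :: real
  assumes h: "2 < h" and V: "set_integrable lborel {0..1} V" and s: "is_sol V y y'"
    and V1: "integral {0..1} (\<lambda>x. \<bar>V x\<bar>) \<le> h\<^sup>2 - 2 * h"
  shows "y 1 \<le> 2 / h * exp (h - 2)"
    and "y 1 = 2 / h * exp (h - 2) \<Longrightarrow>
      AE x in lborel. x \<in> {0..1} \<longrightarrow> V x = h\<^sup>2 * indicator {1/h..1 - 1/h} x"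
proof -
  let ?W = "\<lambda>x. \<bar>V x\<bar>"
  have W: "set_integrable lborel {0..1} ?W" by (rule set_integrable_abs[OF V])
  obtain z z' where z: "is_sol ?W z z'" using is_sol_exists[OF W] by blast
  note Y = is_sol_unfold[OF V s] and Z = is_sol_unfold[OF W z]
  have le: "\<bar>y t\<bar> \<le> z t" if "t \<in> {0..1}" for t
    by (rule is_sol_compare[OF V s W z _ that]) simp
  have zb: "z 1 \<le> 2 / h * exp (h - 2)"
    by (rule nonneg_potential_bound(1)[OF h W z _ V1]) simp
  then show "y 1 \<le> 2 / h * exp (h - 2)" using le[of 1] by simp
  assume eq: "y 1 = 2 / h * exp (h - 2)"
  then have z1: "z 1 = y 1" using le[of 1] zb by (simp only: atLeastAtMost_iff) linarith
  have AW: "AE x in lborel. x \<in> {0..1} \<longrightarrow> ?W x = h\<^sup>2 * indicator {1/h..1 - 1/h} x"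
    by (rule nonneg_potential_bound(2)[OF h W z _ V1]) (use z1 eq in auto)
  let ?f = "\<lambda>s. ?W s * z s - V s * y s"
  have f0: "0 \<le> ?f t" if "t \<in> {0..1}" for t
  proof -
    have "V t * y t \<le> \<bar>V t\<bar> * \<bar>y t\<bar>" by (metis abs_ge_self abs_mult)
    also have "\<dots> \<le> ?W t * z t" using le[OF that] by (intro mult_left_mono) auto
    finally show ?thesis by simp
  qed
  have fi: "set_integrable lborel {0..1} ?f" using Z(3) Y(3) by (rule set_integral_diff(1))
  have diff: "z t - y t = integral {0..t} (\<lambda>s. (t - s) * ?f s)" if t: "t \<in> {0..1}" for t
  proof -
    have *: "(\<lambda>s. (t - s) * (U s * u s)) integrable_on {0..t}" if "set_integrable lborel {0..1} (\<lambda>s. U s * u s)" for U u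
      by (subst mult.commute, intro integrable_on_set_integrable set_integrable_mult_continuous
          set_integrable_Icc_subset[OF that] continuous_intros) (use t in auto)
    show ?thesis
      unfolding right_diff_distrib[of "t - _"] Henstock_Kurzweil_Integration.integral_diff[OF *[OF Z(3)] *[OF Y(3)]]
      using Z(5)[OF t] Y(5)[OF t] by simp
  qed
  \<comment> \<open>The weight \<open>1 - s\<close> vanishes only at \<open>s = 1\<close>, so zero
    integral forces \<open>?f\<close> itself to vanish almost everywhere.\<close>
  have gi: "set_integrable lborel {0..1} (\<lambda>s. (1 - s) * ?f s)"
    by (subst mult.commute, intro set_integrable_mult_continuous fi continuous_intros)
  have "(LINT s:{0..1}|lborel. (1 - s) * ?f s) = 0"
    using diff[of 1] z1 LINT_eq_integral[OF gi] by simp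
  then have "AE x in lborel. indicator {0..1} x *\<^sub>R ((1 - x) * ?f x) = 0"
    unfolding set_lebesgue_integral_def
    by (subst (asm) integral_nonneg_eq_0_iff_AE[OF gi[unfolded set_integrable_def]])
      (use f0 in \<open>auto simp: indicator_def\<close>)
  moreover have "AE x in lborel. x \<noteq> 1" by (rule AE_lborel_singleton)
  ultimately have fz: "AE x in lborel. x \<in> {0..1} \<longrightarrow> ?f x = 0"
    by eventually_elim (auto simp: indicator_def)
  \<comment> \<open>With \<open>?f\<close> zero almost everywhere, the two solutions agree on all of
    \<open>{0..1}\<close>. So \<open>y\<close> inherits positivity from \<open>z\<close>, and
    \<open>\<bar>V\<bar> * y = V * y\<close> can be divided by \<open>y\<close>.\<close>
  have yz: "y t = z t" if t: "t \<in> {0..1}" for t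
  proof -
    have i: "set_integrable lborel {0..t} (\<lambda>s. (t - s) * ?f s)"
      by (subst mult.commute, intro set_integrable_mult_continuous set_integrable_Icc_subset[OF fi] continuous_intros) (use t in auto)
    have "integral {0..t} (\<lambda>s. (t - s) * ?f s) = (LINT s:{0..t}|lborel. (t - s) * ?f s)"
      by (rule LINT_eq_integral[OF i, symmetric])
    also have "\<dots> = (LINT s:{0..t}|lborel. 0)"
      unfolding set_lebesgue_integral_def
      by (rule integral_cong_AE)
        (use borel_measurable_integrable[OF i[unfolded set_integrable_def]] t fz in \<open>auto elim!: eventually_mono simp: indicator_def\<close>)
    finally show ?thesis using diff[OF t] by simp
  qed
  have pos: "0 < y t" if "t \<in> {0<..1}" for t
    using is_sol_ge_id[OF W z, of t] yz[of t] that by auto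
  have "AE x in lborel. x \<noteq> 0" by (rule AE_lborel_singleton)
  with fz AW show "AE x in lborel. x \<in> {0..1} \<longrightarrow> V x = h\<^sup>2 * indicator {1/h..1 - 1/h} x"
  proof eventually_elim
    case (elim x)
    show ?case
    proof
      assume x: "x \<in> {0..1}"
      then have "0 < y x" using pos elim by auto
      moreover have "\<bar>V x\<bar> * y x = V x * y x" using elim x yz[OF x] by simp
      ultimately have "V x = \<bar>V x\<bar>" by simp
      then show "V x = h\<^sup>2 * indicator {1/h..1 - 1/h} x" using elim x by simp
    qed
  qed
qed

section \<open>The sharp bound in terms of \<open>A\<close>\<close>

theorem theoremA:
  fixes A :: real
  assumes "A > 0"
  shows "set_integrable lborel {0..1} (pulse A)
    \<and> (LINT x:{0..1}|lborel. \<bar>pulse A x\<bar>) \<le> A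
    \<and> det_T (pulse A) = 4 / (1 + sqrt (1 + A)) * exp (A / (1 + sqrt (1 + A)))
    \<and> (\<forall>V :: real \<Rightarrow> real. set_integrable lborel {0..1} V
          \<and> (LINT x:{0..1}|lborel. \<bar>V x\<bar>) \<le> A
          \<longrightarrow> det_T V \<le> 4 / (1 + sqrt (1 + A)) * exp (A / (1 + sqrt (1 + A))))
    \<and> (\<forall>V :: real \<Rightarrow> real. set_integrable lborel {0..1} V
          \<and> (LINT x:{0..1}|lborel. \<bar>V x\<bar>) \<le> A
          \<and> det_T V = 4 / (1 + sqrt (1 + A)) * exp (A / (1 + sqrt (1 + A)))
          \<longrightarrow> (AE x in lborel. x \<in> {0..1} \<longrightarrow> V x = pulse A x))"
proof -
  \<comment> \<open>In this parameter \<open>ell A = 1 - 2 / h\<close>, the pulse has height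
    \<open>A / ell A = h\<^sup>2\<close> on \<open>{1/h..1 - 1/h}\<close>, and the exponent
    \<open>A / h\<close> is \<open>h - 2\<close>. All square roots disappear from the
    computation.\<close>
  define h where "h = 1 + sqrt (1 + A)"
  have h: "2 < h" using assms by (simp add: h_def)
  have "(h - 1)\<^sup>2 = 1 + A" using assms by (simp add: h_def)
  then have A: "A = h\<^sup>2 - 2 * h" by (simp add: power2_eq_square algebra_simps)
  have l: "ell A = 1 - 2 / h"
    unfolding ell_def h_def[symmetric] using h by (simp add: A field_simps power2_eq_square)
  have l0: "0 < 1 - 2 / h" using h by (simp add: field_simps)
  have "A / ell A = h\<^sup>2"
    unfolding l using h l0 by (simp add: A divide_simps power2_eq_square) (simp add: algebra_simps)
  moreover have "1/2 - ell A / 2 = 1/h" "1/2 + ell A / 2 = 1 - 1/h" unfolding l by (auto simp: field_simps)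
  ultimately have P: "pulse A = (\<lambda>x. h\<^sup>2 * indicator {1/h..1 - 1/h} x)"
    unfolding pulse_def by (simp only:)
  have B: "4 / h * exp (A / h) = 2 * (2 / h * exp (h - 2))"
    using h by (simp add: A diff_divide_distrib power2_eq_square)
  have Pi: "set_integrable lborel {0..1} (pulse A)"
    unfolding P by (rule set_integrable_indicator_Icc)
  obtain y y' where y: "is_sol (pulse A) y y'" "y 1 = 2 / h * exp (h - 2)"
    using is_sol_pulse[OF h] unfolding P by blast
  have sub: "{1/h..1 - 1/h} \<subseteq> {0..1}" "1/h \<le> 1 - 1/h" using h by (auto simp: field_simps)
  have "(LINT x:{0..1}|lborel. \<bar>pulse A x\<bar>) = (\<integral>x. h\<^sup>2 * indicator {1/h..1 - 1/h} x \<partial>lborel)"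
    unfolding set_lebesgue_integral_def P
  proof (rule Bochner_Integration.integral_cong[OF refl])
    fix x :: real
    show "indicator {0..1} x *\<^sub>R \<bar>h\<^sup>2 * indicator {1/h..1 - 1/h} x\<bar> = h\<^sup>2 * indicator {1/h..1 - 1/h} x"
      using sub(1) by (cases "x \<in> {1/h..1 - 1/h}") (auto simp only: indicator_simps subsetD, auto)
  qed
  also have "\<dots> = h\<^sup>2 * (1 - 1/h - 1/h)" using sub(2) by simp
  also have "\<dots> = A" using h by (simp add: A field_simps power2_eq_square)
  finally have "(LINT x:{0..1}|lborel. \<bar>pulse A x\<bar>) \<le> A" by simp
  moreover have "det_T (pulse A) = 4 / h * exp (A / h)"
    unfolding det_T_eq[OF Pi y(1)] B y(2) ..
  moreover have "det_T V \<le> 4 / h * exp (A / h) \<and>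
      (det_T V = 4 / h * exp (A / h) \<longrightarrow> (AE x in lborel. x \<in> {0..1} \<longrightarrow> V x = pulse A x))"
    if V: "set_integrable lborel {0..1} V" and V1: "(LINT x:{0..1}|lborel. \<bar>V x\<bar>) \<le> A" for V
  proof -
    obtain z z' where z: "is_sol V z z'" using is_sol_exists[OF V] by blast
    have "integral {0..1} (\<lambda>x. \<bar>V x\<bar>) \<le> h\<^sup>2 - 2 * h"
      using V1 LINT_eq_integral[OF set_integrable_abs[OF V]] A by simp
    note b = potential_bound[OF h V z this]
    show ?thesis
      unfolding det_T_eq[OF V z] B P using b by simp
  qed
  ultimately show ?thesis
    using Pi unfolding h_def by blast
qed

end
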